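(* Let $\mathcal{U}$ be a separable Hilbert space, and consider the dynamics $\frac{du}{dt}=F(u)$ on $\mathcal{U}$ with solution semigroup $\Psi_t$, a fixed period $h>0$, the true trajectory $u_j=\Psi_h(u_{j-1})$, $j\in\mathbb{N}$, the observations $y_j$, and the ensembles $V_j=[v_j^{(n)}]_{n=1}^N\in\mathcal{U}^N$ ($N\in\mathbb{N}$) produced by the ensemble transform Kalman filter (ETKF), all as described in the context. Assume: (1) there exists $\rho>0$ such that $\Psi_t$ has an absorbing ball $B(\rho)=\{v\in\mathcal{U}: |v|\le\rho\}$, i.e., $\Psi_t(v)\in B(\rho)$ for any $v\in B(\rho)$ and $t\ge 0$; (2) there exists $\beta>0$ such that $\langle F(u)-F(v),u-v\rangle\le\beta|u-v|^2$ for any $u\in B(\rho)$ and $v\in\mathcal{U}$; (3) the state is fully observed, i.e., $H=I_{\mathcal{U}}$ and $\Gamma=\gamma^2 I_{\mathcal{U}}$ for some $\gamma>0$. Let $E_j=[v_j^{(n)}-u_j]_{n=1}^N$ and $|E_j|_2^2=\frac1N\sum_{n=1}^N|v_j^{(n)}-u_j|^2$ for $j\in\mathbb{N}\cup\{0\}$. Then $$\mathbb{E}\left[|E_j|_2^2\right]\le e^{2\beta hj}\,\mathbb{E}\left[|E_0|_2^2\right]+(N-1)\gamma^2\,\frac{e^{2\beta hj}-1}{e^{2\beta h}-1},\qquad j\in\mathbb{N}.$$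
   Context: **Notation.** $|\cdot|$ and $\langle\cdot,\cdot\rangle$ are the norm and inner product of $\mathcal{U}$; $I_{\mathcal{U}}$ and $I_N$ are the identities on $\mathcal{U}$ and $\mathbb{R}^N$. For $u,v\in\mathcal{U}$, $u\otimes v$ is the operator $w\mapsto u\langle v,w\rangle$. For $U=[u^{(n)}]_{n=1}^N$, $V=[v^{(n)}]_{n=1}^N\in\mathcal{U}^N$: $UV^*=\sum_n u^{(n)}\otimes v^{(n)}$, $U^*V=[\langle u^{(i)},v^{(j)}\rangle]_{i,j=1}^N\in\mathbb{R}^{N\times N}$, and for $T\in\mathbb{R}^{N\times N}$, $UT=[\sum_k u^{(k)}T_{k,n}]_{n=1}^N$. Operators on $\mathcal{U}$ act on $\mathcal{U}^N$ componentwise. For $u\in\mathcal{U}$, $u\mathbf{1}=[u,\dots,u]\in\mathcal{U}^N$. For $V\in\mathcal{U}^N$: $\overline{v}=\frac1N\sum_n v^{(n)}$, $dV=[v^{(n)}-\overline v]_{n=1}^N$, $\mathrm{Cov}(V)=\frac{1}{N-1}dV\,dV^*$. **Model and observations.** For any $u_0\in\mathcal{U}$ the equation $\frac{du}{dt}=F(u)$ is supposed to have a unique solution, and it generates an analytic semigroup $\Psi_t:\mathcal{U}\to\mathcal{U}$, $t\ge0$. The observation space is a Hilbert space $\mathcal{Y}\subset\mathcal{U}$, and the observations are $y_j=Hu_j+\xi_j$, $\xi_j\sim N(0,\Gamma)$, $j\in\mathbb{N}$, where $H:\mathcal{U}\to\mathcal{Y}$ is a bounded linear operator, $\Gamma$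 is a bounded self-adjoint operator on $\mathcal{Y}$ that is positive definite (bounded below by a positive multiple of the identity), and the noise sequence $(\xi_j)_{j\in\mathbb{N}}$ is i.i.d. and independent of $u_0$. $\mathbb{E}$ is the expectation on the underlying probability space. **ETKF.** The members of $V_0=[v_0^{(n)}]_{n=1}^N$ are $N$ independent samples from some probability distribution $\mu_0$. For each $j\in\mathbb{N}$: - Prediction: $\widehat v_j^{(n)}=\Psi_h(v_{j-1}^{(n)})$, $n=1,\dots,N$, and $\widehat V_j=[\widehat v_j^{(n)}]_{n=1}^N$, with mean $\overline{\widehat v}_j$, deviation $d\widehat V_j$, and $\widehat C_j=\mathrm{Cov}(\widehat V_j)$. - Analysis: update the mean by $\overline v_j=\overline{\widehat v}_j+K_j(y_j-H\overline{\widehat v}_j)$ with the Kalman gain $K_j=\widehat C_jH^*(H\widehat C_jH^*+\Gamma)^{-1}$. Take a symmetric transform matrix $T_j\in\mathbb{R}^{N\times N}$ satisfying $\frac1{N-1}d\widehat V_jT_j(d\widehat V_jT_j)^*=(I_{\mathcal{U}}-K_jH)\widehat C_j$, and set $dV_j=d\widehat V_jT_j$. Finally set $V_j=\overline v_j\mathbf{1}+dV_j$. The definition of the ETKF also gives, as an equivalent practical form of the analysis step, the one using $T_j=\left(I_N+\frac{1}{N-1}d\widehat V_j^*H^*\Gamma^{-1}H\,d\widehat V_j\right)^{-1/2}$, $\widetilde T_j=\frac{1}{N-1}T_j^2\,d\widehat V_j^*H^*\Gamma^{-1}(y_j-H\overline{\widehat v}_j)\mathbf{1}+T_j$ and $V_j=\overline{\widehat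 v}_j\mathbf{1}+d\widehat V_j\widetilde T_j$; the source asserts that the symmetric matrix $T_j$ satisfying the covariance identity exists and is unique, obtaining it as this explicit matrix.
   Formalization: Added: u_0 lies in B(ρ) almost surely (the claim is false otherwise, e.g. F(x) = −x(1+cos x) with u_0 large); Ψ_h is Borel measurable; (u_0, V_0) is jointly independent of the noise; T_j is the explicit inverse square root matrix. *)

theory Defs
  imports "HOL-Probability.Probability"
begin

section \<open>Ensembles\<close>

text \<open>
  An ensemble of \<open>N = CARD('n)\<close> members is a vector of type \<open>'a ^ 'n\<close>.
\<close>

definition ens_mean :: "'a::real_vector ^ 'n::finite \<Rightarrow> 'a" where
  "ens_mean V = (1 / real CARD('n)) *\<^sub>R (\<Sum>n\<in>UNIV. V $ n)"

definition ens_const :: "'a \<Rightarrow> 'a ^ 'n::finite" where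
  "ens_const v = (\<chi> n. v)"

definition ens_dev :: "'a::real_vector ^ 'n::finite \<Rightarrow> 'a ^ 'n" where
  "ens_dev V = V - ens_const (ens_mean V)"

definition ens_map :: "('a \<Rightarrow> 'b) \<Rightarrow> 'a ^ 'n::finite \<Rightarrow> 'b ^ 'n" where
  "ens_map f V = (\<chi> n. f (V $ n))"

text \<open>\<open>ens_outer U V\<close> is the operator \<open>U V\<^sup>*\<close> and \<open>ens_gram U V\<close> the matrix \<open>U\<^sup>* V\<close>.\<close>

definition ens_outer :: "'a::real_inner ^ 'n::finite \<Rightarrow> 'a ^ 'n \<Rightarrow> 'a \<Rightarrow> 'a" where
  "ens_outer U V w = (\<Sum>n\<in>UNIV. (V $ n \<bullet> w) *\<^sub>R U $ n)"

definition ens_gram :: "'a::real_inner ^ 'n::finite \<Rightarrow> 'a ^ 'n \<Rightarrow> real ^ 'n ^ 'n" where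
  "ens_gram U V = (\<chi> i j. U $ i \<bullet> V $ j)"

definition ens_mult :: "'a::real_vector ^ 'n::finite \<Rightarrow> real ^ 'n ^ 'n \<Rightarrow> 'a ^ 'n" where
  "ens_mult U T = (\<chi> n. \<Sum>k\<in>UNIV. T $ k $ n *\<^sub>R U $ k)"

text \<open>
  For \<open>N = 1\<close> the deviations vanish and \<open>1 / (N - 1) = 1 / 0 = 0\<close>, so the covariance is zero.
\<close>

definition ens_cov :: "'a::real_inner ^ 'n::finite \<Rightarrow> 'a \<Rightarrow> 'a" where
  "ens_cov V w = (1 / (real CARD('n) - 1)) *\<^sub>R ens_outer (ens_dev V) (ens_dev V) w"


section \<open>Dynamics\<close>

text \<open>
  The differential equation is required for positive times only; at time 0 a solution is
  continuous.
\<close>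

definition is_solution :: "('a::real_normed_vector \<Rightarrow> 'a) \<Rightarrow> 'a \<Rightarrow> (real \<Rightarrow> 'a) \<Rightarrow> bool" where
  "is_solution F u0 u \<longleftrightarrow>
     continuous_on {0..} u \<and> u 0 = u0 \<and>
     (\<forall>t>0. (u has_vector_derivative F (u t)) (at t))"

definition real_analytic_at :: "(real \<Rightarrow> 'a::real_normed_vector) \<Rightarrow> real \<Rightarrow> bool" where
  "real_analytic_at f t \<longleftrightarrow>
     (\<exists>a r. r > 0 \<and> (\<forall>s. \<bar>s - t\<bar> < r \<longrightarrow> (\<lambda>n. (s - t) ^ n *\<^sub>R a n) sums f s))"

definition generates_analytic_semigroup ::
    "('a::real_normed_vector \<Rightarrow> 'a) \<Rightarrow> (real \<Rightarrow> 'a \<Rightarrow> 'a) \<Rightarrow> bool" where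
  "generates_analytic_semigroup F \<Psi> \<longleftrightarrow>
     (\<forall>u0. is_solution F u0 (\<lambda>t. \<Psi> t u0) \<and>
           (\<forall>w. is_solution F u0 w \<longrightarrow> (\<forall>t\<ge>0. w t = \<Psi> t u0))) \<and>
     (\<forall>u0. \<Psi> 0 u0 = u0) \<and>
     (\<forall>s\<ge>0. \<forall>t\<ge>0. \<forall>u0. \<Psi> (s + t) u0 = \<Psi> s (\<Psi> t u0)) \<and>
     (\<forall>u0. \<forall>t>0. real_analytic_at (\<lambda>s. \<Psi> s u0) t)"


section \<open>Observations\<close>

text \<open>
  The observation space is the type \<open>'b\<close>; full observation (\<open>H\<close> the identity) makes it \<open>'a\<close>.
\<close>

definition observation_operators ::
    "('a::real_inner \<Rightarrow> 'b::real_inner) \<Rightarrow> ('b \<Rightarrow> 'b) \<Rightarrow> bool" where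
  "observation_operators H \<Gamma> \<longleftrightarrow>
     bounded_linear H \<and> bounded_linear \<Gamma> \<and>
     (\<forall>x y. \<Gamma> x \<bullet> y = x \<bullet> \<Gamma> y) \<and>
     (\<exists>c>0. \<forall>x. c * (norm x)\<^sup>2 \<le> \<Gamma> x \<bullet> x)"

text \<open>
  The law \<open>N(0, \<Gamma>)\<close> on a Hilbert space, for positive definite \<open>\<Gamma>\<close>, by its one-dimensional
  marginals: \<open>X \<bullet> w\<close> is normal with mean 0 and variance \<open>\<Gamma> w \<bullet> w > 0\<close>
  (\<open>normal_density\<close> takes the standard deviation).
\<close>

definition centered_gaussian ::
    "'w measure \<Rightarrow> ('b::real_inner \<Rightarrow> 'b) \<Rightarrow> ('w \<Rightarrow> 'b) \<Rightarrow> bool" where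
  "centered_gaussian M \<Gamma> X \<longleftrightarrow>
     X \<in> borel_measurable M \<and>
     (\<forall>w. w \<noteq> 0 \<longrightarrow>
        distributed M lborel (\<lambda>\<omega>. X \<omega> \<bullet> w) (normal_density 0 (sqrt (\<Gamma> w \<bullet> w))))"


text \<open>
  Independence of two random variables with values in spaces of different types
  (\<open>indep_var\<close> requires equal types).
\<close>

definition independent_rvs ::
    "'w measure \<Rightarrow> 's measure \<Rightarrow> ('w \<Rightarrow> 's) \<Rightarrow> 't measure \<Rightarrow> ('w \<Rightarrow> 't) \<Rightarrow> bool" where
  "independent_rvs M S X T Y \<longleftrightarrow>
     X \<in> measurable M S \<and> Y \<in> measurable M T \<and>
     prob_space.indep_set M (sets (vimage_algebra (space M) X S))
       (sets (vimage_algebra (space M) Y T))"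


section \<open>The ensemble transform Kalman filter\<close>

definition kalman_gain ::
    "('a::real_inner \<Rightarrow> 'b::real_inner) \<Rightarrow> ('b \<Rightarrow> 'b) \<Rightarrow> ('a \<Rightarrow> 'a) \<Rightarrow> 'b \<Rightarrow> 'a" where
  "kalman_gain H \<Gamma> C =
     (let S = (\<lambda>y. H (C (adjoint H y)) + \<Gamma> y)
      in (\<lambda>y. C (adjoint H (inv S y))))"

definition pos_def_matrix :: "real ^ 'n ^ 'n::finite \<Rightarrow> bool" where
  "pos_def_matrix A \<longleftrightarrow> transpose A = A \<and> (\<forall>x. x \<noteq> 0 \<longrightarrow> 0 < x \<bullet> (A *v x))"

text \<open>\<open>T = A\<^bsup>-1/2\<^esup>\<close> for a symmetric positive definite matrix \<open>A\<close>.\<close>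

definition is_inv_sqrt_matrix :: "real ^ 'n ^ 'n::finite \<Rightarrow> real ^ 'n ^ 'n \<Rightarrow> bool" where
  "is_inv_sqrt_matrix A T \<longleftrightarrow> pos_def_matrix T \<and> T ** T = matrix_inv A"

text \<open>
  The covariance identity alone does not determine a symmetric \<open>T\<close> (with \<open>T\<close>, also \<open>- T\<close>
  satisfies it); the last conjunct selects the solution that the filter uses,
  \<open>(I + (1 / (N - 1)) dV\<^sup>* H\<^sup>* \<Gamma>\<^sup>-\<^sup>1 H dV)\<^bsup>-1/2\<^esup>\<close>, which maps
  the constant vector to itself, so that the analysis ensemble keeps the updated mean.
\<close>

definition is_transform_matrix ::
    "('a::real_inner \<Rightarrow> 'b::real_inner) \<Rightarrow> ('b \<Rightarrow> 'b) \<Rightarrow> 'a ^ 'n::finite \<Rightarrow> real ^ 'n ^ 'n \<Rightarrow> bool" where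
  "is_transform_matrix H \<Gamma> V T \<longleftrightarrow>
     (let C = ens_cov V; K = kalman_gain H \<Gamma> C; D = ens_dev V; DT = ens_mult D T;
          c = 1 / (real CARD('n) - 1)
      in transpose T = T \<and>
         (\<forall>w. c *\<^sub>R ens_outer DT DT w = C w - K (H (C w))) \<and>
         is_inv_sqrt_matrix
           (mat 1 + c *\<^sub>R ens_gram D (ens_map (\<lambda>v. adjoint H (inv \<Gamma> (H v))) D)) T)"

definition etkf_analysis ::
    "('a::real_inner \<Rightarrow> 'b::real_inner) \<Rightarrow> ('b \<Rightarrow> 'b) \<Rightarrow> 'a ^ 'n::finite \<Rightarrow> 'b \<Rightarrow> 'a ^ 'n \<Rightarrow> bool" where
  "etkf_analysis H \<Gamma> Vh y V \<longleftrightarrow>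
     (\<exists>T. is_transform_matrix H \<Gamma> Vh T \<and>
          V = ens_const (ens_mean Vh + kalman_gain H \<Gamma> (ens_cov Vh) (y - H (ens_mean Vh)))
              + ens_mult (ens_dev Vh) T)"

text \<open>
  \<open>S\<close> is the solution map over one observation period; the datum \<open>y 0\<close> is not used.
\<close>

definition etkf ::
    "('a::real_inner \<Rightarrow> 'a) \<Rightarrow> ('a \<Rightarrow> 'b::real_inner) \<Rightarrow> ('b \<Rightarrow> 'b) \<Rightarrow>
     (nat \<Rightarrow> 'b) \<Rightarrow> (nat \<Rightarrow> 'a ^ 'n::finite) \<Rightarrow> bool" where
  "etkf S H \<Gamma> y V \<longleftrightarrow>
     (\<forall>j. etkf_analysis H \<Gamma> (ens_map S (V j)) (y (Suc j)) (V (Suc j)))"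

definition mean_square_error :: "'a::real_normed_vector ^ 'n::finite \<Rightarrow> 'a \<Rightarrow> real" where
  "mean_square_error V u = (1 / real CARD('n)) * (\<Sum>n\<in>UNIV. (norm (V $ n - u))\<^sup>2)"

end

theory Submission
  imports Defs
begin

text \<open>
  Write \<open>D\<close> for the forecast deviations, \<open>G = D\<^sup>* D\<close>, \<open>b = 1 / ((N - 1) \<gamma>\<^sup>2)\<close>, \<open>A = I + b G\<close> and
  \<open>B = A\<^bsup>-1\<^esup> = T\<^sup>2\<close>. The Kalman gain is \<open>K = b D B D\<^sup>*\<close>. If the forecast mean has error \<open>e\<close>, the
  analysis mean has error \<open>(I - K) e + K \<xi>\<close>. Here \<open>|(I - K) e| \<le> |e|\<close>, and since \<open>\<xi>\<close> is centered and
  independent of the forecast, the noise contributes \<open>\<gamma>\<^sup>2 tr (K\<^sup>2) = \<gamma>\<^sup>2 tr ((I - B)\<^sup>2) \<le> (N - 1) \<gamma>\<^sup>2\<close>,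
  because \<open>0 \<le> I - B \<le> I\<close> annihilates constant vectors. The deviations do not grow, as \<open>T\<^sup>2 \<le> I\<close>.
  The forecast step expands the squared error by at most \<open>exp (2 \<beta> h)\<close> by Gronwall, and the resulting
  recursion is geometric.

  Independence can be exploited only if the ensembles are measurable functions of the initial data
  and the past noise. To this end, \<open>A \<mapsto> A\<^bsup>-1/2\<^esup>\<close> is shown to be continuous by the closed graph
  theorem for maps into compact sets, using the uniqueness of positive semidefinite square roots.
\<close>

section \<open>The inverse square root of a matrix\<close>

text \<open>Moving from \<open>x\<close> a short way against \<open>y = T x\<close> changes the
  quadratic form by \<open>- 2 t |y|^2\<close> to first order, so a nonzero \<open>y\<close> would
  make the form negative.\<close>

lemma psd_kernel:
  fixes T :: "real ^ 'n ^ 'n::finite"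
  assumes sym: "transpose T = T" and psd: "\<And>x. 0 \<le> x \<bullet> (T *v x)"
    and x: "x \<bullet> (T *v x) = 0"
  shows "T *v x = 0"
proof (rule ccontr)
  assume neq: "T *v x \<noteq> 0"
  define y where "y = T *v x"
  define a where "a = y \<bullet> y"
  define b where "b = y \<bullet> (T *v y)"
  \<comment> \<open>Small enough for the linear term to dominate; the \<open>+ 1\<close> covers
    \<open>b = 0\<close>. The form then equals \<open>- (t^2 + t a)\<close>.\<close>
  define t where "t = a / (b + 1)"
  have "a > 0" using neq by (simp add: a_def y_def)
  have "b \<ge> 0" using psd by (simp add: b_def)
  have xy: "x \<bullet> (T *v y) = a"
    by (metis a_def dot_lmul_matrix sym y_def vector_transpose_matrix)
  have "0 \<le> (x - t *\<^sub>R y) \<bullet> (T *v (x - t *\<^sub>R y))" by (rule psd)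
  also have "\<dots> = t\<^sup>2 * b - 2 * t * a"
    using x xy
    by (simp add: matrix_vector_mult_diff_distrib matrix_vector_mult_scaleR inner_diff_left
        inner_diff_right y_def[symmetric] power2_eq_square)
       (simp add: a_def b_def algebra_simps)
  also have "\<dots> = t * (t * (b + 1)) - t\<^sup>2 - 2 * t * a"
    by (simp add: power2_eq_square algebra_simps)
  also have "t * (b + 1) = a" using \<open>b \<ge> 0\<close> by (simp add: t_def)
  also have "t * a - t\<^sup>2 - 2 * t * a = - (t\<^sup>2 + t * a)" by simp
  finally have "t\<^sup>2 + t * a \<le> 0" by simp
  moreover have "t > 0" using \<open>a > 0\<close> \<open>b \<ge> 0\<close> by (simp add: t_def)
  ultimately have False using \<open>a > 0\<close> by (smt (verit) mult_pos_pos zero_le_power2)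
  then show False .
qed

text \<open>
  The entrywise bound follows from \<open>A \<ge> I\<close> in the application; it is included so that the graph of
  the square root lies over a compact set.
\<close>

definition inv_sqrt_rel :: "real ^ 'n ^ 'n::finite \<Rightarrow> real ^ 'n ^ 'n \<Rightarrow> bool" where
  "inv_sqrt_rel A T \<longleftrightarrow> transpose T = T \<and> (\<forall>x. 0 \<le> x \<bullet> (T *v x)) \<and>
     (\<forall>i j. \<bar>T $ i $ j\<bar> \<le> 1) \<and> A ** (T ** T) = mat 1"

lemma trace_conv_inner: "trace M = (\<Sum>i\<in>UNIV. axis i 1 \<bullet> (M *v axis i 1))"
  by (simp add: trace_def inner_axis' matrix_vector_mul_component) (simp add: inner_axis)

text \<open>Equal squares give \<open>T1 D + D T2 = 0\<close> for \<open>D = T1 - T2\<close>.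
  Multiplying by \<open>D\<close> and taking traces yields two nonnegative numbers with sum zero, so
  both vanish. The kernel lemma then gives \<open>T1 D = 0\<close>, and \<open>T1\<close> is
  injective because \<open>A\<close> inverts its square.\<close>

lemma inv_sqrt_rel_unique:
  assumes "inv_sqrt_rel A T1" "inv_sqrt_rel A T2"
  shows "T1 = T2"
proof -
  have s: "transpose T1 = T1" "transpose T2 = T2" 
    and p1: "\<And>x. 0 \<le> x \<bullet> (T1 *v x)" and p2: "\<And>x. 0 \<le> x \<bullet> (T2 *v x)"
    and A: "A ** (T1 ** T1) = mat 1" "A ** (T2 ** T2) = mat 1"
    using assms by (auto simp: inv_sqrt_rel_def)
  have A': "(T1 ** T1) ** A = mat 1"
    using A(1) by (simp add: matrix_left_right_inverse)
  have sq: "T1 ** T1 = T2 ** T2"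
    by (metis A'  A(2) matrix_mul_assoc matrix_mul_lid matrix_mul_rid)
  define D where "D = T1 - T2"
  have symD: "transpose D = D" using s by (simp add: D_def transpose_def vec_eq_iff)
  have ac: "T1 ** D = - (D ** T2)"
    using sq by (simp add: D_def vec_eq_iff matrix_matrix_mult_def left_diff_distrib
        right_diff_distrib sum_subtractf)
  have q: "axis i 1 \<bullet> ((D ** T ** D) *v axis i 1) = (D *v axis i 1) \<bullet> (T *v (D *v axis i 1))" for T i
    by (metis symD dot_lmul_matrix matrix_vector_mul_assoc vector_transpose_matrix)
  have "trace (D ** T1 ** D) = trace (D ** - (D ** T2))"
    using ac by (simp add: matrix_mul_assoc[symmetric])
  also have "\<dots> = - trace (D ** T2 ** D)"
    using trace_mul_sym[of D "D ** T2"] by (simp add: trace_def matrix_matrix_mult_def sum_negf)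
  finally have tr: "trace (D ** T1 ** D) + trace (D ** T2 ** D) = 0" by simp
  have "trace (D ** T1 ** D) \<ge> 0" "trace (D ** T2 ** D) \<ge> 0"
    unfolding trace_conv_inner q by (intro sum_nonneg p1 p2)+
  then have "trace (D ** T1 ** D) = 0" using tr by linarith
  then have z: "(D *v axis i 1) \<bullet> (T1 *v (D *v axis i 1)) = 0" for i
    unfolding trace_conv_inner q by (subst (asm) sum_nonneg_eq_0_iff) (auto simp: p1)
  have "T1 *v (D *v axis i 1) = 0" for i
    using psd_kernel[OF s(1) p1 z] .
  then have "D *v axis i 1 = 0" for i
    using A' by (metis matrix_left_right_inverse matrix_vector_mul_assoc matrix_vector_mul_lid matrix_vector_mult_0_right)
  then have "D = 0"
    by (simp add: matrix_vector_mul_component vec_eq_iff inner_axis)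
  then show ?thesis by (simp add: D_def)
qed

text \<open>All clauses are equations or non-strict inequalities between continuous functions of the
  pair, so each cuts out a closed set. Strict definiteness would not do so by itself.\<close>

lemma closed_inv_sqrt_rel: "closed {(A, T). inv_sqrt_rel A T}"
proof -
  have "{(A, T). inv_sqrt_rel A T} =
     (\<Inter>i j. {x. snd x $ i $ j = snd x $ j $ i}) \<inter> (\<Inter>x. {y. 0 \<le> x \<bullet> (snd y *v x)}) \<inter>
     (\<Inter>i j. {x. \<bar>snd x $ i $ j\<bar> \<le> 1}) \<inter>
     (\<Inter>i j. {x. (fst x ** (snd x ** snd x)) $ i $ j = mat 1 $ i $ j})"
    by (auto simp: inv_sqrt_rel_def transpose_def vec_eq_iff)
  also have "closed \<dots>"
    unfolding matrix_matrix_mult_def matrix_vector_mult_def inner_vec_def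
    by (intro closed_Int closed_INT ballI closed_Collect_eq closed_Collect_le)
       (auto intro!: continuous_intros)
  finally show ?thesis .
qed

text \<open>
  The value 0 where no square root exists keeps the function total without an existence proof
  and makes the analysis step return the forecast mean there.
\<close>

definition inv_sqrt :: "real ^ 'n ^ 'n::finite \<Rightarrow> real ^ 'n ^ 'n" where
  "inv_sqrt A = (if \<exists>T. inv_sqrt_rel A T then THE T. inv_sqrt_rel A T else 0)"

lemma inv_sqrt_eq: "inv_sqrt_rel A T \<Longrightarrow> inv_sqrt A = T"
  using inv_sqrt_rel_unique[of A] by (auto simp: inv_sqrt_def intro!: the_equality)

lemma borel_measurable_inv_sqrt:
  "(inv_sqrt :: real ^ 'n ^ 'n::finite \<Rightarrow> _) \<in> borel_measurable borel"
proof -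
  define S :: "(real ^ 'n ^ 'n) set" where "S = {A. \<exists>T. inv_sqrt_rel A T}"
  define C :: "(real ^ 'n ^ 'n) set" where "C = {T. \<forall>i j. \<bar>T $ i $ j\<bar> \<le> 1}"
  have "closed C"
    unfolding C_def by (intro closed_Collect_all closed_Collect_le) (auto intro!: continuous_intros)
  moreover have "bounded C"
    unfolding bounded_iff C_def
  proof (intro exI ballI)
    fix T :: "real ^ 'n ^ 'n" assume "T \<in> {T. \<forall>i j. \<bar>T $ i $ j\<bar> \<le> 1}"
    then have T: "\<bar>T $ i $ j\<bar> \<le> 1" for i j by auto
    have "norm T \<le> (\<Sum>i\<in>UNIV. norm (T $ i))"
      by (simp add: norm_vec_def L2_set_le_sum)
    also have "\<dots> \<le> (\<Sum>i\<in>UNIV. \<Sum>j\<in>UNIV. \<bar>T $ i $ j\<bar>)"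
      by (intro sum_mono norm_le_l1_cart)
    also have "\<dots> \<le> (\<Sum>i\<in>(UNIV::'n set). \<Sum>j\<in>(UNIV::'n set). 1)"
      by (intro sum_mono T)
    finally show "norm T \<le> (\<Sum>i\<in>(UNIV::'n set). \<Sum>j\<in>(UNIV::'n set). 1)" .
  qed
  ultimately have C: "compact C" by (simp add: compact_eq_bounded_closed)
  have "closed {(T, A). inv_sqrt_rel A (T :: real^'n^'n)}"
  proof -
    have "{(T, A). inv_sqrt_rel A (T :: real^'n^'n)} = prod.swap -` {(A, T). inv_sqrt_rel A T}" by auto
    then show ?thesis
      using closed_inv_sqrt_rel by (metis closed_vimage continuous_on_swap)
  qed
  \<comment> \<open>Projecting a closed set along a compact factor keeps it closed; hence the
    matrices that have a root form a closed set.\<close>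
  from closed_compact_projection[OF C this]
  have S: "closed S"
    by (rule back_subst[where P = closed]) (auto simp: S_def C_def inv_sqrt_rel_def)
  have "continuous_on S inv_sqrt"
  proof (rule continuous_from_closed_graph[OF C])
    show "inv_sqrt \<in> S \<rightarrow> C"
      by (auto simp: S_def inv_sqrt_eq C_def) (auto simp: inv_sqrt_rel_def)
    have "(\<lambda>A. (A, inv_sqrt A)) ` S = {(A, T). inv_sqrt_rel A T}"
      by (auto simp: S_def inv_sqrt_eq image_iff)
    then show "closed ((\<lambda>A. (A, inv_sqrt A)) ` S)"
      using closed_inv_sqrt_rel by simp
  qed
  then have "(\<lambda>A. indicator S A *\<^sub>R inv_sqrt A) \<in> borel_measurable borel"
    using S by (intro borel_measurable_continuous_on_indicator) auto
  \<comment> \<open>Off \<open>S\<close> the default value is 0, so the cutoff changes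
    nothing.\<close>
  also have "(\<lambda>A. indicator S A *\<^sub>R inv_sqrt A) = inv_sqrt"
    by (auto simp: fun_eq_iff S_def inv_sqrt_def indicator_def)
  finally show ?thesis .
qed


section \<open>The analysis step\<close>

lemma sum_ens_dev: "(\<Sum>n\<in>UNIV. ens_dev V $ n) = 0"
  by (simp add: ens_dev_def ens_const_def ens_mean_def sum_subtractf sum_constant_scaleR)

text \<open>The cross terms add up to an inner product with the sum of \<open>W\<close> and vanish.
  With \<open>W\<close> the forecast deviations or the transformed deviations, this separates the
  error of the mean from the spread.\<close>

lemma mean_square_error_const_plus:
  fixes W :: "'a::real_inner ^ 'n::finite"
  assumes "(\<Sum>n\<in>UNIV. W $ n) = 0"
  shows "mean_square_error (ens_const m + W) u =
    (norm (m - u))\<^sup>2 + (1 / real CARD('n)) * (\<Sum>n\<in>UNIV. (norm (W $ n))\<^sup>2)"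
proof -
  have "(\<Sum>n\<in>UNIV. (norm ((ens_const m + W) $ n - u))\<^sup>2) =
      (\<Sum>n\<in>UNIV. (norm (m - u))\<^sup>2 + 2 * ((m - u) \<bullet> W $ n) + (norm (W $ n))\<^sup>2)"
    by (intro sum.cong refl) (simp add: ens_const_def power2_norm_eq_inner inner_simps inner_commute)
  also have "\<dots> = real CARD('n) * (norm (m - u))\<^sup>2 + 2 * ((m - u) \<bullet> (\<Sum>n\<in>UNIV. W $ n))
      + (\<Sum>n\<in>UNIV. (norm (W $ n))\<^sup>2)"
    by (simp add: sum.distrib inner_sum_right sum_distrib_left)
  finally show ?thesis
    using assms by (simp add: mean_square_error_def distrib_left)
qed

lemma mean_square_error_decomp:
  fixes V :: "'a::real_inner ^ 'n::finite"
  shows "mean_square_error V u = (norm (ens_mean V - u))\<^sup>2 +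
    (1 / real CARD('n)) * (\<Sum>n\<in>UNIV. (norm (ens_dev V $ n))\<^sup>2)"
  using mean_square_error_const_plus[OF sum_ens_dev[of V], of "ens_mean V" u]
  by (simp add: ens_dev_def)

text \<open>The operator \<open>b D B D^*\<close>. With \<open>B\<close> the inverse of
  \<open>I + b D^* D\<close> it is the Kalman gain expressed through an \<open>N\<close> by
  \<open>N\<close> matrix, so that no operator on the Hilbert space has to be inverted.\<close>

definition ens_gain :: "real \<Rightarrow> 'a::real_inner ^ 'n::finite \<Rightarrow> real ^ 'n ^ 'n \<Rightarrow> 'a \<Rightarrow> 'a" where
  "ens_gain b D B x = (\<Sum>i\<in>UNIV. (b * (\<Sum>j\<in>UNIV. B $ i $ j * (D $ j \<bullet> x))) *\<^sub>R D $ i)"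

lemma ens_gain_add: "ens_gain b D B (x + y) = ens_gain b D B x + ens_gain b D B y"
  by (simp add: ens_gain_def inner_simps algebra_simps sum.distrib)

lemma ens_gain_diff: "ens_gain b D B (x - y) = ens_gain b D B x - ens_gain b D B y"
  by (simp add: ens_gain_def inner_simps algebra_simps sum_subtractf)

lemma ens_gram_psd: "x \<bullet> (ens_gram D D *v x) \<ge> 0"
proof -
  have "x \<bullet> (ens_gram D D *v x) = (\<Sum>i\<in>UNIV. x $ i *\<^sub>R D $ i) \<bullet> (\<Sum>i\<in>UNIV. x $ i *\<^sub>R D $ i)"
    by (simp add: inner_vec_def matrix_vector_mult_def ens_gram_def inner_sum_left inner_sum_right
        sum_distrib_left mult_ac inner_commute)
  then show ?thesis by simp
qed

section \<open>Algebra of the gain and the transform in ensemble coordinates\<close>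

locale ens_transform =
  fixes D :: "'a::real_inner ^ 'n::finite" and b :: real and T :: "real ^ 'n ^ 'n"
  assumes b_nonneg: "b \<ge> 0" and sum_D: "(\<Sum>n\<in>UNIV. D $ n) = 0"
    and T_sqrt: "inv_sqrt_rel (mat 1 + b *\<^sub>R ens_gram D D) T"
begin

definition "G = ens_gram D D"
definition "B = T ** T"
definition "z x = B *v (\<chi> i. D $ i \<bullet> x)"

lemma T_sym: "T $ i $ j = T $ j $ i"
  using T_sqrt by (auto simp: inv_sqrt_rel_def transpose_def vec_eq_iff)

lemma T_psd: "0 \<le> x \<bullet> (T *v x)"
  using T_sqrt by (auto simp: inv_sqrt_rel_def)

lemma B_sym: "B $ i $ j = B $ j $ i"
  unfolding B_def matrix_matrix_mult_def using T_sym by (simp add: mult.commute)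

lemma G_nth: "G $ i $ j = D $ i \<bullet> D $ j" by (simp add: G_def ens_gram_def)

lemma AB: "(mat 1 + b *\<^sub>R G) ** B = mat 1"
  using T_sqrt by (simp add: inv_sqrt_rel_def B_def G_def)

lemma BA: "B ** (mat 1 + b *\<^sub>R G) = mat 1"
  using AB by (simp add: matrix_left_right_inverse)

lemma AB_vec: "B *v x + b *\<^sub>R (G *v (B *v x)) = x"
proof -
  have "((mat 1 + b *\<^sub>R G) ** B) *v x = x" by (simp add: AB)
  then show ?thesis
    by (simp add: matrix_vector_mul_assoc[symmetric] matrix_vector_mult_add_rdistrib
        scaleR_matrix_vector_assoc[symmetric])
qed

lemma BA_vec: "B *v (x + b *\<^sub>R (G *v x)) = x"
proof -
  have "(B ** (mat 1 + b *\<^sub>R G)) *v x = x" by (simp add: BA)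
  then show ?thesis
    by (simp add: matrix_vector_mul_assoc[symmetric] matrix_vector_mult_add_rdistrib
        scaleR_matrix_vector_assoc[symmetric])
qed

lemma gain_z: "ens_gain b D B x = (\<Sum>i\<in>UNIV. (b * z x $ i) *\<^sub>R D $ i)"
  by (simp add: ens_gain_def z_def matrix_vector_mult_def)

text \<open>In operator form, \<open>D^* (I - K) = (I - b G B) D^* = B D^*\<close>, by
  \<open>(I + b G) B = I\<close>.\<close>

lemma inner_residual: "D $ i \<bullet> (x - ens_gain b D B x) = z x $ i"
proof -
  have "z x + b *\<^sub>R (G *v z x) = (\<chi> i. D $ i \<bullet> x)"
    unfolding z_def by (rule AB_vec)
  then have "z x $ i + b * (\<Sum>j\<in>UNIV. (D $ i \<bullet> D $ j) * z x $ j) = D $ i \<bullet> x"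
    by (simp add: vec_eq_iff matrix_vector_mult_def G_nth)
  then show ?thesis
    by (simp add: gain_z inner_diff_right inner_sum_right sum_distrib_left mult_ac)
qed

text \<open>By the residual formula, the inner product of \<open>K x\<close> with
  \<open>x - K x\<close> is \<open>b |z x|^2\<close>, which is nonnegative. Subtracting such a
  vector \<open>K x\<close> from \<open>x\<close> cannot increase the norm.\<close>

lemma norm_residual_le: "norm (x - ens_gain b D B x) \<le> norm x"
proof -
  let ?K = "ens_gain b D B x"
  have K: "?K \<bullet> v = b * (\<Sum>i\<in>UNIV. z x $ i * (D $ i \<bullet> v))" for v
    by (simp add: gain_z inner_sum_left sum_distrib_left mult_ac)
  have "?K \<bullet> (x - ?K) = b * (\<Sum>i\<in>UNIV. (z x $ i)\<^sup>2)"
    unfolding K inner_residual by (simp add: power2_eq_square)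
  also have "\<dots> \<ge> 0" using b_nonneg by (intro mult_nonneg_nonneg sum_nonneg) auto
  finally have "?K \<bullet> x \<ge> ?K \<bullet> ?K" by (simp add: inner_diff_right)
  moreover have "?K \<bullet> ?K \<ge> 0" by simp
  moreover have "(x - ?K) \<bullet> (x - ?K) = x \<bullet> x - 2 * (?K \<bullet> x) + ?K \<bullet> ?K"
    by (simp add: inner_simps inner_commute)
  ultimately have "(x - ?K) \<bullet> (x - ?K) \<le> x \<bullet> x" by linarith
  then show ?thesis by (simp add: norm_le)
qed

text \<open>The gain in ensemble coordinates: \<open>D^* K = P D^*\<close>, since
  \<open>P = b G B\<close>.\<close>

definition "P = mat 1 - B"

lemma P_eq: "P = b *\<^sub>R (B ** G)" "P = b *\<^sub>R (G ** B)"
proof -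
  have "B + b *\<^sub>R (B ** G) = mat 1"
    using BA by (simp add: matrix_add_ldistrib matrix_scalar_ac scalar_matrix_assoc[symmetric])
  then show "P = b *\<^sub>R (B ** G)" by (simp add: P_def algebra_simps)
  have "(mat 1 + b *\<^sub>R G) ** B = B + b *\<^sub>R (G ** B)"
    by (simp add: matrix_eq matrix_vector_mult_add_rdistrib matrix_vector_mul_assoc[symmetric]
        scaleR_matrix_vector_assoc[symmetric])
  then show "P = b *\<^sub>R (G ** B)" using AB by (simp add: P_def algebra_simps)
qed

lemma P_sym: "P $ i $ j = P $ j $ i"
  by (simp add: P_def B_sym mat_def)

text \<open>\<open>G\<close> annihilates constant vectors because the members of \<open>D\<close>
  sum to zero; so \<open>I + b G\<close> fixes them, and so does its inverse.\<close>

lemma B_ones: "B *v (\<chi> i. 1) = (\<chi> i. 1)"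
proof -
  have "G *v (\<chi> i. 1) = (0 :: real ^ 'n)"
    by (simp add: vec_eq_iff matrix_vector_mult_def G_nth inner_sum_right[symmetric] sum_D)
  then show ?thesis using BA_vec[of "\<chi> i. 1"] by simp
qed

lemma G_psd: "x \<bullet> (G *v x) \<ge> 0"
  unfolding G_def by (rule ens_gram_psd)

text \<open>In \<open>x = B x + P x\<close> the two summands have a nonnegative inner product,
  namely \<open>b\<close> times the quadratic form of \<open>G\<close> at
  \<open>B x\<close>.\<close>

lemma norm_P_le: "norm (P *v x) \<le> norm x"
proof -
  have Px: "P *v x = b *\<^sub>R (G *v (B *v x))"
    by (simp add: P_eq(2) scaleR_matrix_vector_assoc[symmetric] matrix_vector_mul_assoc)
  then have x: "x = B *v x + P *v x" using AB_vec[of x] by simp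
  have "x \<bullet> x = (B *v x) \<bullet> (B *v x) + 2 * ((B *v x) \<bullet> (P *v x)) + (P *v x) \<bullet> (P *v x)"
    by (subst (1 2) x) (simp add: inner_simps inner_commute)
  moreover have "(B *v x) \<bullet> (P *v x) \<ge> 0"
    unfolding Px using b_nonneg G_psd[of "B *v x"] by simp
  moreover have "(B *v x) \<bullet> (B *v x) \<ge> 0" by simp
  ultimately show ?thesis by (simp add: norm_le)
qed

text \<open>
  Since \<open>P\<close> annihilates the constant vector, the \<open>i\<close>-th unit vector may be replaced by its
  projection onto the mean-zero vectors; this turns \<open>N\<close> into \<open>N - 1\<close> in the final bound.
\<close>

lemma P_column: "(\<Sum>k\<in>UNIV. (P $ k $ i)\<^sup>2) \<le> 1 - 1 / real CARD('n)"
proof -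
  let ?N = "real CARD('n)"
  define x :: "real ^ 'n" where "x = axis i 1 - (1 / ?N) *\<^sub>R (\<chi> i. 1)"
  have "P *v x = P *v axis i 1"
    by (simp add: x_def matrix_vector_mult_diff_distrib matrix_vector_mult_scaleR)
       (simp add: P_def matrix_vector_mult_diff_rdistrib B_ones)
  moreover have "(P *v axis i 1) $ k = P $ k $ i" for k
    by (simp add: matrix_vector_mul_component inner_axis)
  ultimately have "(\<Sum>k\<in>UNIV. (P $ k $ i)\<^sup>2) = (P *v x) \<bullet> (P *v x)"
    by (simp add: inner_vec_def power2_eq_square)
  also have "\<dots> \<le> x \<bullet> x" using norm_P_le[of x] by (simp add: norm_le)
  also have "\<dots> = 1 - 1 / ?N"
  proof -
    have 1: "axis i 1 \<bullet> (\<chi> i. (1 :: real)) = 1" by (simp add: inner_axis')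
    have 2: "(\<chi> i::'n. (1 :: real)) \<bullet> (\<chi> i. 1) = ?N" by (simp add: inner_vec_def)
    have 3: "axis i (1::real) \<bullet> axis i 1 = 1" by (simp add: inner_axis_axis)
    have 4: "(\<chi> i. (1 :: real)) \<bullet> axis i 1 = 1" by (simp add: inner_axis)
    show ?thesis
      unfolding x_def by (simp add: inner_diff_left inner_diff_right 1 2 3 4)
  qed
  finally show ?thesis .
qed

text \<open>Chosen so that \<open>K\<close> is the sum of the rank-one operators
  \<open>D_i \<otimes> w_i\<close>; the noise then enters only through finitely many
  scalars.\<close>

definition "w i = (\<Sum>m\<in>UNIV. (b * B $ i $ m) *\<^sub>R D $ m)"

lemma gain_w: "ens_gain b D B x = (\<Sum>i\<in>UNIV. (x \<bullet> w i) *\<^sub>R D $ i)"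
  by (simp add: ens_gain_def w_def inner_sum_right sum_distrib_left mult_ac inner_commute)

text \<open>The left side is the squared Hilbert-Schmidt norm of \<open>K\<close>, written without
  an orthonormal basis. It equals the sum of the squared entries of \<open>P\<close>, to which each
  of the \<open>N\<close> columns contributes at most \<open>1 - 1/N\<close>.\<close>

lemma gain_hilbert_schmidt:
  "(\<Sum>i\<in>UNIV. \<Sum>j\<in>UNIV. (w i \<bullet> w j) * (D $ i \<bullet> D $ j)) \<le> real CARD('n) - 1"
proof -
  have PBG: "b * (\<Sum>j\<in>UNIV. B $ k $ j * G $ j $ i) = P $ k $ i" for k i
    by (simp add: P_eq(1) matrix_matrix_mult_def)
  have wD: "w i \<bullet> D $ k = P $ i $ k" for i k
    by (simp add: P_eq(1) w_def matrix_matrix_mult_def inner_sum_left sum_distrib_left G_nth mult_ac)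
  have ww: "w i \<bullet> w j = b * (\<Sum>k\<in>UNIV. B $ j $ k * P $ i $ k)" for i j
    by (subst (2) w_def) (simp add: inner_sum_right wD sum_distrib_left mult_ac)
  have "(\<Sum>i\<in>UNIV. \<Sum>j\<in>UNIV. (w i \<bullet> w j) * (D $ i \<bullet> D $ j))
      = (\<Sum>i\<in>UNIV. \<Sum>j\<in>UNIV. \<Sum>k\<in>UNIV. P $ i $ k * (b * (B $ k $ j * G $ j $ i)))"
    by (simp add: ww sum_distrib_left sum_distrib_right mult_ac B_sym G_nth inner_commute)
  also have "\<dots> = (\<Sum>i\<in>UNIV. \<Sum>k\<in>UNIV. \<Sum>j\<in>UNIV. P $ i $ k * (b * (B $ k $ j * G $ j $ i)))"
    by (intro sum.cong refl sum.swap)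
  also have "\<dots> = (\<Sum>i\<in>UNIV. \<Sum>k\<in>UNIV. P $ i $ k * P $ k $ i)"
    by (simp only: sum_distrib_left[symmetric] PBG)
  also have "\<dots> = (\<Sum>i\<in>UNIV. \<Sum>k\<in>UNIV. (P $ k $ i)\<^sup>2)"
    by (simp add: P_sym power2_eq_square)
  also have "\<dots> \<le> (\<Sum>i\<in>(UNIV::'n set). 1 - 1 / real CARD('n))"
    by (intro sum_mono P_column)
  also have "\<dots> = real CARD('n) - 1" by (simp add: right_diff_distrib)
  finally show ?thesis .
qed

text \<open>\<open>T\<close> fixes the constant vector \<open>1\<close>: for
  \<open>x = T 1 - 1\<close> one has \<open>(T + I) x = T^2 1 - 1 = 0\<close>, and positivity of
  \<open>T\<close> forces \<open>x = 0\<close>. Hence transforming the deviations does not shift the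
  ensemble mean.\<close>

lemma sum_ens_mult: "(\<Sum>n\<in>UNIV. ens_mult D T $ n) = 0"
proof -
  define x where "x = T *v (\<chi> i. 1) - (\<chi> i. 1)"
  have "T *v x + x = 0"
    using B_ones by (simp add: x_def B_def matrix_vector_mult_diff_distrib matrix_vector_mul_assoc)
  then have "x \<bullet> (T *v x) + x \<bullet> x = 0" by (metis inner_add_right inner_zero_right)
  then have "x \<bullet> x = 0" using T_psd[of x] inner_ge_zero[of x] by linarith
  then have "x = 0" by simp
  then have "(\<Sum>n\<in>UNIV. T $ k $ n) = 1" for k
    by (simp add: x_def vec_eq_iff matrix_vector_mult_def)
  then show ?thesis
    unfolding ens_mult_def
    by (simp, subst sum.swap) (simp add: scaleR_sum_left[symmetric] sum_D)
qed

text \<open>The left side is \<open>tr (B G) = tr G - tr (P G)\<close>, and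
  \<open>tr (P G) = b tr (B G G)\<close> is \<open>b\<close> times the sum of the squared entries of
  \<open>T G\<close>, hence nonnegative.\<close>

lemma sum_norm_ens_mult_le:
  "(\<Sum>n\<in>UNIV. (norm (ens_mult D T $ n))\<^sup>2) \<le> (\<Sum>n\<in>UNIV. (norm (D $ n))\<^sup>2)"
proof -
  have "(\<Sum>n\<in>UNIV. (norm (ens_mult D T $ n))\<^sup>2)
      = (\<Sum>n\<in>UNIV. \<Sum>k\<in>UNIV. \<Sum>l\<in>UNIV. T $ k $ n * T $ n $ l * G $ l $ k)"
    by (simp add: ens_mult_def power2_norm_eq_inner inner_sum_left inner_sum_right
        sum_distrib_left G_nth inner_commute T_sym mult_ac)
  also have "\<dots> = (\<Sum>k\<in>UNIV. \<Sum>l\<in>UNIV. \<Sum>n\<in>UNIV. T $ k $ n * T $ n $ l * G $ l $ k)"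
    by (subst sum.swap) (intro sum.cong refl sum.swap)
  also have "\<dots> = trace (B ** G)"
    by (simp add: trace_def B_def matrix_matrix_mult_def sum_distrib_right)
  also have "\<dots> = trace G - trace (P ** G)"
    by (simp add: P_def trace_def matrix_matrix_mult_def left_diff_distrib sum_subtractf mat_def
        if_distrib[of "\<lambda>x. x * _"] cong: if_cong)
  also have "trace (P ** G) = b * trace (B ** G ** G)"
    by (simp add: P_eq(1) trace_def matrix_matrix_mult_def sum_distrib_left mult_ac)
  also have "trace (B ** G ** G) = trace ((G ** T) ** (T ** G))"
    using trace_mul_sym[of "B ** G" G] by (simp add: B_def matrix_mul_assoc)
  also have "\<dots> = (\<Sum>i\<in>UNIV. \<Sum>j\<in>UNIV. ((T ** G) $ j $ i)\<^sup>2)"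
    by (subst (1) trace_def, subst (1) matrix_matrix_mult_def)
       (simp add: matrix_matrix_mult_def power2_eq_square T_sym G_nth inner_commute mult_ac)
  also have "trace G - b * \<dots> \<le> trace G"
    using b_nonneg by (simp add: sum_nonneg)
  also have "trace G = (\<Sum>n\<in>UNIV. (norm (D $ n))\<^sup>2)"
    by (simp add: trace_def G_nth power2_norm_eq_inner)
  finally show ?thesis .
qed

end

section \<open>Identifying the filter step with an explicit map\<close>

lemma kalman_gain_eq:
  fixes V :: "'a::real_inner ^ 'n::finite"
  assumes "\<gamma> > 0" and b: "b = 1 / ((real CARD('n) - 1) * \<gamma>\<^sup>2)"
    and T: "inv_sqrt_rel (mat 1 + b *\<^sub>R ens_gram (ens_dev V) (ens_dev V)) T"
  shows "kalman_gain (\<lambda>v. v) (\<lambda>v. \<gamma>\<^sup>2 *\<^sub>R v) (ens_cov V) x = ens_gain b (ens_dev V) (T ** T) x"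
proof -
  define D where "D = ens_dev V"
  \<comment> \<open>This includes \<open>N = 1\<close>, where division by zero makes both sides
    0.\<close>
  have c: "1 / (real CARD('n) - 1) = \<gamma>\<^sup>2 * b" using \<open>\<gamma> > 0\<close> by (simp add: b)
  have "b \<ge> 0" by (simp add: b)
  then interpret ens_transform D b T
    using T by unfold_locales (simp_all add: D_def sum_ens_dev)
  have C: "ens_cov V w = (\<gamma>\<^sup>2 * b) *\<^sub>R (\<Sum>n\<in>UNIV. (D $ n \<bullet> w) *\<^sub>R D $ n)" for w
    by (simp add: ens_cov_def ens_outer_def c D_def)
  have adj: "adjoint (\<lambda>v::'a. v) = (\<lambda>v. v)" by (rule adjoint_unique) simp
  define S where "S y = ens_cov V y + \<gamma>\<^sup>2 *\<^sub>R y" for y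
  have S_diff: "S (y - y') = S y - S y'" for y y'
    by (simp add: S_def C inner_diff_right scaleR_diff_left scaleR_diff_right sum_subtractf)
  have S_inner: "S y \<bullet> y \<ge> \<gamma>\<^sup>2 * (y \<bullet> y)" for y
    using \<open>b \<ge> 0\<close> by (simp add: S_def C inner_add_left inner_sum_left sum_nonneg)
  have "inj S"
  proof (rule injI)
    fix y y' assume "S y = S y'"
    then have "\<gamma>\<^sup>2 * ((y - y') \<bullet> (y - y')) \<le> 0"
      using S_inner[of "y - y'"] by (simp add: S_diff)
    then have "(y - y') \<bullet> (y - y') \<le> 0" using \<open>\<gamma> > 0\<close> by (simp add: mult_le_0_iff)
    then have "(y - y') \<bullet> (y - y') = 0" using inner_ge_zero[of "y - y'"] by linarith
    then show "y = y'" by simp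
  qed
  define K where "K = ens_gain b D B x"
  \<comment> \<open>The guessed preimage of \<open>x\<close> under \<open>S\<close>: the covariance
    maps it to \<open>K\<close>, by \<open>inner_residual\<close>, and \<open>\<gamma>\<close>
    squared times \<open>y\<close> supplies the rest \<open>x - K\<close>. With injectivity this
    evaluates \<open>inv S\<close>.\<close>
  define y where "y = (1 / \<gamma>\<^sup>2) *\<^sub>R (x - K)"
  have Cy: "ens_cov V y = K"
    using \<open>\<gamma> > 0\<close> by (simp add: C y_def K_def inner_residual scaleR_sum_right)
      (simp add: gain_z)
  have "S y = x" using \<open>\<gamma> > 0\<close> by (simp add: S_def Cy) (simp add: y_def)
  then have "inv S x = y" using \<open>inj S\<close> by (simp add: inv_f_eq)
  then show ?thesis
    by (simp add: kalman_gain_def adj Let_def S_def[symmetric] Cy)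
      (simp add: K_def D_def B_def)
qed

text \<open>As quadratic forms \<open>A \<ge> I\<close>, so \<open>A\<close> is invertible, its
  inverse is a contraction, and so is the root \<open>T\<close> of that inverse. This bounds the
  entries of \<open>T\<close> by 1.\<close>

lemma is_transform_matrix_inv_sqrt:
  fixes V :: "'a::real_inner ^ 'n::finite"
  assumes "\<gamma> > 0" and b: "b = 1 / ((real CARD('n) - 1) * \<gamma>\<^sup>2)"
    and T: "is_transform_matrix (\<lambda>v. v) (\<lambda>v. \<gamma>\<^sup>2 *\<^sub>R v) V T"
  shows "inv_sqrt_rel (mat 1 + b *\<^sub>R ens_gram (ens_dev V) (ens_dev V)) T"
proof -
  define D where "D = ens_dev V"
  define A where "A = mat 1 + b *\<^sub>R ens_gram D D"
  have "b \<ge> 0" by (simp add: b)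
  have adj: "adjoint (\<lambda>v::'a. v) = (\<lambda>v. v)" by (rule adjoint_unique) simp
  have inv: "inv (\<lambda>v::'a. \<gamma>\<^sup>2 *\<^sub>R v) v = (1 / \<gamma>\<^sup>2) *\<^sub>R v" for v
    using \<open>\<gamma> > 0\<close> by (intro inv_f_eq injI) auto
  have "mat 1 + (1 / (real CARD('n) - 1)) *\<^sub>R
      ens_gram D (ens_map (\<lambda>v. adjoint (\<lambda>v. v) (inv (\<lambda>v. \<gamma>\<^sup>2 *\<^sub>R v) v)) D) = A"
    by (simp add: A_def adj inv ens_gram_def ens_map_def vec_eq_iff b)
  then have T_inv: "is_inv_sqrt_matrix A T"
    using T by (simp add: is_transform_matrix_def Let_def D_def)
  then have sym: "transpose T = T" and pos: "x \<noteq> 0 \<Longrightarrow> 0 < x \<bullet> (T *v x)"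
    and TT: "T ** T = matrix_inv A" for x
    by (auto simp: is_inv_sqrt_matrix_def pos_def_matrix_def)
  have Av: "A *v y = y + b *\<^sub>R (ens_gram D D *v y)" for y
    by (simp add: A_def matrix_vector_mult_add_rdistrib scaleR_matrix_vector_assoc)
  have A_ge: "y \<bullet> y \<le> y \<bullet> (A *v y)" for y
    using \<open>b \<ge> 0\<close> ens_gram_psd[of y D] by (simp add: Av inner_add_right)
  have "A *v y = 0 \<Longrightarrow> y = 0" for y
    using A_ge[of y] inner_ge_zero[of y] by (metis antisym inner_eq_zero_iff inner_zero_right)
  then have "invertible A"
    by (simp add: invertible_left_inverse matrix_left_invertible_ker)
  then obtain A' where "A ** A' = mat 1 \<and> A' ** A = mat 1" by (auto simp: invertible_def)
  \<comment> \<open>\<open>matrix_inv\<close> is a Hilbert choice, so an inverse has to be exhibited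
    first.\<close>
  then have "A ** matrix_inv A = mat 1"
    unfolding matrix_inv_def by (rule someI2) auto
  then have ATT: "A ** (T ** T) = mat 1" by (simp add: TT)
  have "norm (T *v x) \<le> norm x" for x
  proof -
    \<comment> \<open>Here \<open>A y = x\<close> and \<open>|T x|^2 = x \<bullet> y\<close>. From
      \<open>A \<ge> I\<close> follows \<open>|y|^2 \<le> x \<bullet> y \<le> |x| |y|\<close>, hence
      \<open>|y| \<le> |x|\<close>.\<close>
    define y where "y = T *v (T *v x)"
    have Ay: "A *v y = x" using ATT by (simp add: y_def matrix_vector_mul_assoc)
    have xy: "x \<bullet> y = (T *v x) \<bullet> (T *v x)"
      by (metis y_def sym dot_lmul_matrix vector_transpose_matrix)
    have "norm y * norm y \<le> norm x * norm y"
      using A_ge[of y] norm_cauchy_schwarz[of x y]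
      by (simp add: Ay inner_commute power2_norm_eq_inner[symmetric] power2_eq_square)
    then have "norm y \<le> norm x" by (cases "y = 0") auto
    then have "x \<bullet> y \<le> norm x * norm x"
      using norm_cauchy_schwarz[of x y] by (meson mult_left_mono norm_ge_zero order_trans)
    then have "(T *v x) \<bullet> (T *v x) \<le> x \<bullet> x"
      by (simp add: xy power2_norm_eq_inner[symmetric] power2_eq_square)
    then show ?thesis by (simp add: norm_le)
  qed
  note T_contr = this
  have "\<bar>T $ i $ j\<bar> \<le> 1" for i j
  proof -
    have "T $ i $ j = (T *v axis j 1) $ i" by (simp add: matrix_vector_mul_component inner_axis)
    also have "\<bar>\<dots>\<bar> \<le> norm (T *v axis j 1)" by (rule component_le_norm_cart)
    also have "\<dots> \<le> 1" using T_contr[of "axis j 1"] by (simp add: norm_axis_1)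
    finally show ?thesis .
  qed
  moreover have "0 \<le> x \<bullet> (T *v x)" for x
    using pos[of x] by (cases "x = 0") auto
  ultimately show ?thesis
    using sym ATT by (simp add: inv_sqrt_rel_def A_def D_def)
qed

text \<open>For \<open>N = 1\<close>, \<open>b = 1 / 0 = 0\<close>, in accordance with \<open>ens_cov\<close> being zero.\<close>

definition etkf_map :: "real \<Rightarrow> 'a::real_inner ^ 'n::finite \<Rightarrow> 'a \<Rightarrow> 'a ^ 'n" where
  "etkf_map \<gamma> V y =
    (let D = ens_dev V; b = 1 / ((real CARD('n) - 1) * \<gamma>\<^sup>2);
         T = inv_sqrt (mat 1 + b *\<^sub>R ens_gram D D)
     in ens_const (ens_mean V + ens_gain b D (T ** T) (y - ens_mean V)) + ens_mult D T)"

text \<open>Uniqueness of the root turns the existential choice of \<open>T\<close> into a function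
  of forecast and observation, whose measurability can then be studied.\<close>

lemma etkf_analysis_eq_map:
  assumes "\<gamma> > 0" "etkf_analysis (\<lambda>v. v) (\<lambda>v. \<gamma>\<^sup>2 *\<^sub>R v) Vh y V"
  shows "V = etkf_map \<gamma> Vh y"
proof -
  obtain T where T: "is_transform_matrix (\<lambda>v. v) (\<lambda>v. \<gamma>\<^sup>2 *\<^sub>R v) Vh T"
    and V: "V = ens_const (ens_mean Vh + kalman_gain (\<lambda>v. v) (\<lambda>v. \<gamma>\<^sup>2 *\<^sub>R v) (ens_cov Vh)
      (y - ens_mean Vh)) + ens_mult (ens_dev Vh) T"
    using assms(2) by (auto simp: etkf_analysis_def)
  note R = is_transform_matrix_inv_sqrt[OF assms(1) refl T]
  show ?thesis
    by (simp add: V etkf_map_def Let_def kalman_gain_eq[OF assms(1) refl R] inv_sqrt_eq[OF R])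
qed

section \<open>Measurability of the filter map and of the error\<close>

lemma borel_measurable_matrix:
  fixes f :: "'x \<Rightarrow> real ^ 'n::finite ^ 'm::finite"
  assumes "\<And>i j. (\<lambda>x. f x $ i $ j) \<in> borel_measurable M"
  shows "f \<in> borel_measurable M"
  unfolding borel_measurable_euclidean_space[where f = f]
  using assms by (auto simp: Basis_vec_def inner_axis)

lemma borel_measurable_matrix_nth:
  "(\<lambda>x :: real ^ 'n::finite ^ 'm::finite. x $ i $ j) \<in> borel_measurable borel"
  by (intro borel_measurable_continuous_onI continuous_intros)

lemma borel_measurable_etkf_map:
  fixes V :: "'x \<Rightarrow> 'a::{real_inner, second_countable_topology} ^ 'n::finite"
  assumes [measurable]: "\<And>k. (\<lambda>x. V x $ k) \<in> borel_measurable M" "y \<in> borel_measurable M"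
  shows "(\<lambda>x. etkf_map \<gamma> (V x) (y x) $ n) \<in> borel_measurable M"
proof -
  define b where "b = 1 / ((real CARD('n) - 1) * \<gamma>\<^sup>2)"
  define T where "T x = inv_sqrt (mat 1 + b *\<^sub>R ens_gram (ens_dev (V x)) (ens_dev (V x)))" for x
  have [measurable]: "(\<lambda>x. ens_mean (V x)) \<in> borel_measurable M"
    unfolding ens_mean_def by measurable
  have [measurable]: "(\<lambda>x. ens_dev (V x) $ k) \<in> borel_measurable M" for k
    unfolding ens_dev_def ens_const_def by simp
  have "(\<lambda>x. mat 1 + b *\<^sub>R ens_gram (ens_dev (V x)) (ens_dev (V x))) \<in> borel_measurable M"
    by (rule borel_measurable_matrix) (simp add: ens_gram_def)
  then have "T \<in> borel_measurable M"
    unfolding T_def by (rule measurable_compose[OF _ borel_measurable_inv_sqrt])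
  then have [measurable]: "(\<lambda>x. T x $ i $ j) \<in> borel_measurable M" for i j
    by (rule measurable_compose[OF _ borel_measurable_matrix_nth])
  have "(\<lambda>x. ens_gain b (ens_dev (V x)) (T x ** T x) (y x - ens_mean (V x))) \<in> borel_measurable M"
    unfolding ens_gain_def matrix_matrix_mult_def by simp
  moreover have "(\<lambda>x. ens_mult (ens_dev (V x)) (T x) $ n) \<in> borel_measurable M"
    unfolding ens_mult_def by simp
  ultimately show ?thesis
    by (simp add: etkf_map_def Let_def b_def[symmetric] T_def[symmetric] ens_const_def)
qed

lemma borel_measurable_mean_square_error:
  fixes V :: "'x \<Rightarrow> 'a::{real_inner, second_countable_topology} ^ 'n::finite"
  assumes [measurable]: "\<And>k. (\<lambda>x. V x $ k) \<in> borel_measurable M" "u \<in> borel_measurable M"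
  shows "(\<lambda>x. mean_square_error (V x) (u x)) \<in> borel_measurable M"
  unfolding mean_square_error_def by measurable

lemma mean_square_error_nonneg: "mean_square_error V u \<ge> 0"
  by (simp add: mean_square_error_def sum_nonneg)

section \<open>Noise moments and the expected error after one analysis step\<close>

lemma (in prob_space) centered_gaussian_moments:
  fixes X :: "'a \<Rightarrow> 'b::real_inner"
  assumes X: "centered_gaussian M (\<lambda>v. \<gamma>\<^sup>2 *\<^sub>R v) X" and "\<gamma> > 0"
  shows "integrable M (\<lambda>\<omega>. X \<omega> \<bullet> v)" "expectation (\<lambda>\<omega>. X \<omega> \<bullet> v) = 0"
    "integrable M (\<lambda>\<omega>. (X \<omega> \<bullet> v) * (X \<omega> \<bullet> w))"
    "expectation (\<lambda>\<omega>. (X \<omega> \<bullet> v) * (X \<omega> \<bullet> w)) = \<gamma>\<^sup>2 * (v \<bullet> w)"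
proof -
  have lin: "integrable M (\<lambda>\<omega>. X \<omega> \<bullet> v) \<and> expectation (\<lambda>\<omega>. X \<omega> \<bullet> v) = 0 \<and>
      integrable M (\<lambda>\<omega>. (X \<omega> \<bullet> v)\<^sup>2) \<and> expectation (\<lambda>\<omega>. (X \<omega> \<bullet> v)\<^sup>2) = \<gamma>\<^sup>2 * (v \<bullet> v)" for v
  \<comment> \<open>\<open>centered_gaussian\<close> prescribes a density in nonzero directions
    only; in direction 0 all moments vanish.\<close>
  proof (cases "v = 0")
    case False
    define \<sigma> where "\<sigma> = sqrt (\<gamma>\<^sup>2 *\<^sub>R v \<bullet> v)"
    have \<sigma>: "\<sigma> > 0" using False \<open>\<gamma> > 0\<close> by (simp add: \<sigma>_def)
    have D: "distributed M lborel (\<lambda>\<omega>. X \<omega> \<bullet> v) (normal_density 0 \<sigma>)"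
      using X False by (simp add: centered_gaussian_def \<sigma>_def)
    have E: "expectation (\<lambda>\<omega>. X \<omega> \<bullet> v) = 0"
      by (rule normal_distributed_expectation[OF \<sigma> D])
    have 1: "integrable M (\<lambda>\<omega>. X \<omega> \<bullet> v)"
      using distributed_integrable[OF D, of "\<lambda>x. x"] integrable_normal_moment[OF \<sigma>, of 0 1] by simp
    have 2: "integrable M (\<lambda>\<omega>. (X \<omega> \<bullet> v)\<^sup>2)"
      using distributed_integrable[OF D, of "\<lambda>x. x\<^sup>2"] integrable_normal_moment[OF \<sigma>, of 0 2] by simp
    have "expectation (\<lambda>\<omega>. (X \<omega> \<bullet> v)\<^sup>2) = \<sigma>\<^sup>2"
      using normal_distributed_variance[OF \<sigma> D] E by simp
    then show ?thesis using E 1 2 \<open>\<gamma> > 0\<close> by (simp add: \<sigma>_def)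
  qed simp
  show "integrable M (\<lambda>\<omega>. X \<omega> \<bullet> v)" "expectation (\<lambda>\<omega>. X \<omega> \<bullet> v) = 0"
    using lin by auto
  \<comment> \<open>Only one-dimensional marginals are prescribed, so mixed moments are obtained by
    polarization from the directions \<open>v\<close>, \<open>w\<close> and
    \<open>v + w\<close>.\<close>
  have polar: "(\<lambda>\<omega>. (X \<omega> \<bullet> v) * (X \<omega> \<bullet> w)) =
      (\<lambda>\<omega>. (1 / 2) * ((X \<omega> \<bullet> (v + w))\<^sup>2 - (X \<omega> \<bullet> v)\<^sup>2 - (X \<omega> \<bullet> w)\<^sup>2))"
    by (auto simp: inner_add_right power2_eq_square algebra_simps)
  show "integrable M (\<lambda>\<omega>. (X \<omega> \<bullet> v) * (X \<omega> \<bullet> w))"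
    unfolding polar using lin by auto
  have "expectation (\<lambda>\<omega>. (X \<omega> \<bullet> v) * (X \<omega> \<bullet> w)) =
      (1 / 2) * (\<gamma>\<^sup>2 * ((v + w) \<bullet> (v + w)) - \<gamma>\<^sup>2 * (v \<bullet> v) - \<gamma>\<^sup>2 * (w \<bullet> w))"
    unfolding polar using lin[of v] lin[of w] lin[of "v + w"] by simp
  also have "\<dots> = \<gamma>\<^sup>2 * (v \<bullet> w)"
    by (simp add: inner_simps inner_commute algebra_simps)
  finally show "expectation (\<lambda>\<omega>. (X \<omega> \<bullet> v) * (X \<omega> \<bullet> w)) = \<gamma>\<^sup>2 * (v \<bullet> w)" .
qed

text \<open>Forecast and truth are frozen here and only the noise is random; independence later
  allows the estimate to be integrated over the past.\<close>

lemma (in prob_space) etkf_map_error: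
  fixes X :: "'a \<Rightarrow> 'b::{real_inner, second_countable_topology}" and V :: "'b ^ 'n::finite"
  assumes X: "centered_gaussian M (\<lambda>v. \<gamma>\<^sup>2 *\<^sub>R v) X" and "\<gamma> > 0"
  shows "(\<integral>\<^sup>+\<omega>. ennreal (mean_square_error (etkf_map \<gamma> V (u + X \<omega>)) u) \<partial>M)
    \<le> ennreal (mean_square_error V u + (real CARD('n) - 1) * \<gamma>\<^sup>2)"
proof -
  define D where "D = ens_dev V"
  define b where "b = 1 / ((real CARD('n) - 1) * \<gamma>\<^sup>2)"
  define A where "A = mat 1 + b *\<^sub>R ens_gram D D"
  define T where "T = inv_sqrt A"
  define e where "e = ens_mean V - u"
  have "b \<ge> 0" by (simp add: b_def)
  have map_eq: "etkf_map \<gamma> V y =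
      ens_const (ens_mean V + ens_gain b D (T ** T) (y - ens_mean V)) + ens_mult D T" for y
    by (simp add: etkf_map_def Let_def D_def b_def T_def A_def)
  show ?thesis
  proof (cases "\<exists>T. inv_sqrt_rel A T")
    \<comment> \<open>Without a root the default \<open>T = 0\<close> collapses the analysis
      ensemble to the forecast mean, whose squared error is one part of the forecast error.\<close>
    case False
    then have "T = 0" by (simp add: T_def inv_sqrt_def)
    then have "ens_mult D T $ n = 0" "ens_gain b D (T ** T) y = 0" for n y
      by (simp_all add: ens_mult_def ens_gain_def matrix_matrix_mult_def)
    then have mse: "mean_square_error (etkf_map \<gamma> V y) u = (norm e)\<^sup>2" for y
      by (simp add: map_eq mean_square_error_const_plus e_def)
    have "(norm e)\<^sup>2 \<le> mean_square_error V u"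
      by (simp add: mean_square_error_decomp e_def sum_nonneg)
    moreover have "(real CARD('n) - 1) * \<gamma>\<^sup>2 \<ge> 0" by simp
    ultimately have "(norm e)\<^sup>2 \<le> mean_square_error V u + (real CARD('n) - 1) * \<gamma>\<^sup>2" by linarith
    then show ?thesis by (simp add: mse emeasure_space_1 ennreal_leI del: ennreal_plus)
  next
    case True
    then have R: "inv_sqrt_rel A T" using inv_sqrt_eq T_def by metis
    then interpret ens_transform D b T
      using \<open>b \<ge> 0\<close> by unfold_locales (simp_all add: D_def sum_ens_dev A_def)
    define a where "a = e - ens_gain b D B e"
    define \<tau> where "\<tau> = (1 / real CARD('n)) * (\<Sum>n\<in>UNIV. (norm (ens_mult D T $ n))\<^sup>2)"
    have \<tau>: "\<tau> \<le> (1 / real CARD('n)) * (\<Sum>n\<in>UNIV. (norm (D $ n))\<^sup>2)"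
      unfolding \<tau>_def by (intro mult_left_mono sum_norm_ens_mult_le) simp
    \<comment> \<open>The error as a quadratic polynomial in the scalars
      \<open>X \<omega> \<bullet> w i\<close>, so that first and second moments determine its
      expectation.\<close>
    define g where "g \<omega> = (norm a)\<^sup>2 + 2 * (\<Sum>i\<in>UNIV. (X \<omega> \<bullet> w i) * (a \<bullet> D $ i)) +
      (\<Sum>i\<in>UNIV. \<Sum>j\<in>UNIV. ((X \<omega> \<bullet> w i) * (X \<omega> \<bullet> w j)) * (D $ i \<bullet> D $ j)) + \<tau>" for \<omega>
    have g: "mean_square_error (etkf_map \<gamma> V (u + X \<omega>)) u = g \<omega>" for \<omega>
    proof -
      \<comment> \<open>The innovation is the noise minus the error of the forecast mean.\<close>
      have "u + X \<omega> - ens_mean V = X \<omega> - e" by (simp add: e_def)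
      then have "ens_mean V + ens_gain b D B (u + X \<omega> - ens_mean V) - u =
          a + ens_gain b D B (X \<omega>)"
        by (simp add: ens_gain_diff ens_gain_add a_def e_def)
      then have "mean_square_error (etkf_map \<gamma> V (u + X \<omega>)) u =
          (norm (a + ens_gain b D B (X \<omega>)))\<^sup>2 + \<tau>"
        unfolding map_eq B_def[symmetric]
        by (simp add: mean_square_error_const_plus[OF sum_ens_mult] \<tau>_def)
      also have "(norm (a + ens_gain b D B (X \<omega>)))\<^sup>2 =
          (norm a)\<^sup>2 + 2 * (a \<bullet> ens_gain b D B (X \<omega>)) +
          ens_gain b D B (X \<omega>) \<bullet> ens_gain b D B (X \<omega>)"
        by (simp add: power2_norm_eq_inner inner_simps inner_commute)
      also have "a \<bullet> ens_gain b D B (X \<omega>) = (\<Sum>i\<in>UNIV. (X \<omega> \<bullet> w i) * (a \<bullet> D $ i))"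
        by (simp add: gain_w inner_sum_right)
      also have "ens_gain b D B (X \<omega>) \<bullet> ens_gain b D B (X \<omega>) =
          (\<Sum>i\<in>UNIV. \<Sum>j\<in>UNIV. ((X \<omega> \<bullet> w i) * (X \<omega> \<bullet> w j)) * (D $ i \<bullet> D $ j))"
        unfolding gain_w inner_sum_left inner_sum_right
        by (intro sum.cong refl) (simp add: inner_commute)
      finally show ?thesis by (simp add: g_def)
    qed
    note moments = centered_gaussian_moments[OF X \<open>\<gamma> > 0\<close>]
    have int: "integrable M g"
      unfolding g_def
      by (intro Bochner_Integration.integrable_add integrable_mult_right integrable_mult_left
          Bochner_Integration.integrable_sum integrable_const moments)
    have "expectation g = (norm a)\<^sup>2 +
        \<gamma>\<^sup>2 * (\<Sum>i\<in>UNIV. \<Sum>j\<in>UNIV. (w i \<bullet> w j) * (D $ i \<bullet> D $ j)) + \<tau>"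
      unfolding g_def by (simp add: moments prob_space) (simp add: sum_distrib_left mult.assoc)
    also have "\<dots> \<le> (norm e)\<^sup>2 + \<gamma>\<^sup>2 * (real CARD('n) - 1) +
        (1 / real CARD('n)) * (\<Sum>n\<in>UNIV. (norm (D $ n))\<^sup>2)"
      using norm_residual_le[of e] \<tau>
      by (intro add_mono mult_left_mono gain_hilbert_schmidt power_mono) (auto simp: a_def)
    also have "\<dots> = mean_square_error V u + (real CARD('n) - 1) * \<gamma>\<^sup>2"
      by (simp add: mean_square_error_decomp D_def e_def)
    finally have "expectation g \<le> mean_square_error V u + (real CARD('n) - 1) * \<gamma>\<^sup>2" .
    moreover have "AE \<omega> in M. 0 \<le> g \<omega>"
      by (simp add: g[symmetric] mean_square_error_nonneg)
    ultimately show ?thesis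
      by (simp add: g nn_integral_eq_integral[OF int] ennreal_leI del: ennreal_plus)
  qed
qed


section \<open>The forecast step\<close>

text \<open>Gronwall: the weight \<open>exp (- 2 * \<beta> * t)\<close> cancels exactly the growth
  that the one-sided bound permits, so the weighted squared distance is nonincreasing.\<close>

lemma solution_contraction:
  fixes F :: "'a::real_inner \<Rightarrow> 'a"
  assumes u: "is_solution F u0 u" and v: "is_solution F v0 v"
    and one_sided: "\<And>t. t > 0 \<Longrightarrow> (F (u t) - F (v t)) \<bullet> (u t - v t) \<le> \<beta> * (norm (u t - v t))\<^sup>2"
    and "h > 0"
  shows "(norm (u h - v h))\<^sup>2 \<le> exp (2 * \<beta> * h) * (norm (u0 - v0))\<^sup>2"
proof -
  define \<phi> where "\<phi> t = exp (- 2 * \<beta> * t) * ((u t - v t) \<bullet> (u t - v t))" for t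
  have cont: "continuous_on {0..h} u" "continuous_on {0..h} v"
    using u v by (auto simp: is_solution_def intro: continuous_on_subset)
  have "\<phi> h \<le> \<phi> 0"
  \<comment> \<open>The equation holds at positive times only; at time 0 continuity
    suffices.\<close>
  proof (rule DERIV_nonpos_imp_decreasing_open[of 0 h \<phi>])
    fix t :: real assume "0 < t"
    then have [derivative_intros]: "(u has_vector_derivative F (u t)) (at t)"
      "(v has_vector_derivative F (v t)) (at t)"
      using u v by (auto simp: is_solution_def)
    define d where "d = u t - v t"
    define d' where "d' = F (u t) - F (v t)"
    have "((\<lambda>t. u t - v t) has_vector_derivative d') (at t)"
      unfolding d'_def by (auto intro!: derivative_intros)
    then have "((\<lambda>t. (u t - v t) \<bullet> (u t - v t)) has_vector_derivative (d \<bullet> d' + d' \<bullet> d)) (at t)"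
      unfolding d_def by (intro bounded_bilinear.has_vector_derivative[OF bounded_bilinear_inner])
    then have "((\<lambda>t. (u t - v t) \<bullet> (u t - v t)) has_real_derivative (2 * (d' \<bullet> d))) (at t)"
      by (simp add: has_real_derivative_iff_has_vector_derivative inner_commute)
    then have "(\<phi> has_real_derivative
        exp (- 2 * \<beta> * t) * (2 * (d' \<bullet> d)) + exp (- 2 * \<beta> * t) * (- 2 * \<beta>) * (d \<bullet> d)) (at t)"
      unfolding \<phi>_def d_def by (auto intro!: derivative_eq_intros)
    moreover have "exp (- 2 * \<beta> * t) * (2 * (d' \<bullet> d)) + exp (- 2 * \<beta> * t) * (- 2 * \<beta>) * (d \<bullet> d) =
        2 * exp (- 2 * \<beta> * t) * (d' \<bullet> d - \<beta> * (norm d)\<^sup>2)"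
      by (simp add: power2_norm_eq_inner algebra_simps)
    moreover have "\<dots> \<le> 0"
      using one_sided[OF \<open>0 < t\<close>] by (intro mult_nonneg_nonpos) (auto simp: d_def d'_def)
    ultimately show "\<exists>y. (\<phi> has_real_derivative y) (at t) \<and> y \<le> 0" by auto
  qed (use \<open>h > 0\<close> cont in \<open>auto simp: \<phi>_def intro!: continuous_intros\<close>)
  then have "(norm (u h - v h))\<^sup>2 * exp (- 2 * \<beta> * h) \<le> (norm (u0 - v0))\<^sup>2"
    using u v by (simp add: \<phi>_def is_solution_def power2_norm_eq_inner mult.commute)
  then have "exp (2 * \<beta> * h) * ((norm (u h - v h))\<^sup>2 * exp (- 2 * \<beta> * h))
      \<le> exp (2 * \<beta> * h) * (norm (u0 - v0))\<^sup>2" by (intro mult_left_mono) auto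
  also have "exp (2 * \<beta> * h) * ((norm (u h - v h))\<^sup>2 * exp (- 2 * \<beta> * h)) =
      (norm (u h - v h))\<^sup>2 * (exp (2 * \<beta> * h) * exp (- 2 * \<beta> * h))" by simp
  also have "exp (2 * \<beta> * h) * exp (- 2 * \<beta> * h) = 1" by (simp add: exp_add[symmetric])
  finally show ?thesis by simp
qed

lemma mean_square_error_map_le:
  assumes "\<And>n. (norm (f (V $ n) - f u))\<^sup>2 \<le> a * (norm (V $ n - u))\<^sup>2"
  shows "mean_square_error (ens_map f V) (f u) \<le> a * mean_square_error V u"
proof -
  have "(\<Sum>n\<in>UNIV. (norm (ens_map f V $ n - f u))\<^sup>2) \<le> (\<Sum>n\<in>UNIV. a * (norm (V $ n - u))\<^sup>2)"
    using assms by (intro sum_mono) (simp add: ens_map_def)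
  then show ?thesis
    by (simp add: mean_square_error_def sum_distrib_left[symmetric] divide_right_mono)
qed

section \<open>Independence\<close>

lemma (in prob_space) indep_var_imp_independent_rvs:
  assumes "indep_var S X T Y"
  shows "independent_rvs M S X T Y"
proof -
  have "X \<in> measurable M S" "Y \<in> measurable M T"
    using assms by (blast dest: indep_var_rv1 indep_var_rv2)+
  then show ?thesis
    using assms
    unfolding independent_rvs_def indep_var_eq sets_vimage_algebra by auto
qed

text \<open>The joint law is the product of the marginal laws, so Tonelli applies. Both integrals
  are taken over \<open>M\<close>, the outer variable freezing \<open>X\<close>, in place of a
  conditional expectation.\<close>

lemma (in prob_space) nn_integral_independent:
  assumes ind: "independent_rvs M S X T Y" and g: "g \<in> borel_measurable (S \<Otimes>\<^sub>M T)"
  shows "(\<integral>\<^sup>+\<omega>. g (X \<omega>, Y \<omega>) \<partial>M) = (\<integral>\<^sup>+\<omega>'. (\<integral>\<^sup>+\<omega>. g (X \<omega>', Y \<omega>) \<partial>M) \<partial>M)"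
proof -
  have [measurable]: "X \<in> measurable M S" "Y \<in> measurable M T"
    using ind by (auto simp: independent_rvs_def)
  interpret X: prob_space "distr M S X" by (rule prob_space_distr) simp
  interpret Y: prob_space "distr M T Y" by (rule prob_space_distr) simp
  have "distr M S X \<Otimes>\<^sub>M distr M T Y = distr M (S \<Otimes>\<^sub>M T) (\<lambda>\<omega>. (X \<omega>, Y \<omega>))"
  \<comment> \<open>It suffices to compare the measures on rectangles, where independence is the
    product formula.\<close>
  proof (rule pair_measure_eqI)
    fix A B assume "A \<in> sets (distr M S X)" "B \<in> sets (distr M T Y)"
    then have [measurable]: "A \<in> sets S" "B \<in> sets T" by auto
    have XA: "X -` A \<inter> space M \<in> sets (vimage_algebra (space M) X S)"
      and YB: "Y -` B \<inter> space M \<in> sets (vimage_algebra (space M) Y T)"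
      by (auto intro: in_vimage_algebra)
    have "prob ((X -` A \<inter> space M) \<inter> (Y -` B \<inter> space M)) =
        prob (X -` A \<inter> space M) * prob (Y -` B \<inter> space M)"
      using ind XA YB by (intro indep_setD) (auto simp: independent_rvs_def)
    moreover have "(X -` A \<inter> space M) \<inter> (Y -` B \<inter> space M) =
        (\<lambda>\<omega>. (X \<omega>, Y \<omega>)) -` (A \<times> B) \<inter> space M" by auto
    ultimately show "emeasure (distr M S X) A * emeasure (distr M T Y) B =
        emeasure (distr M (S \<Otimes>\<^sub>M T) (\<lambda>\<omega>. (X \<omega>, Y \<omega>))) (A \<times> B)"
      by (simp add: emeasure_distr emeasure_eq_measure ennreal_mult[symmetric])
  next
    show "sigma_finite_measure (distr M S X)" by unfold_locales
    show "sigma_finite_measure (distr M T Y)" by unfold_locales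
    show "sets (distr M S X \<Otimes>\<^sub>M distr M T Y) = sets (distr M (S \<Otimes>\<^sub>M T) (\<lambda>\<omega>. (X \<omega>, Y \<omega>)))"
      by (simp cong: sets_pair_measure_cong)
  qed
  then have "(\<integral>\<^sup>+\<omega>. g (X \<omega>, Y \<omega>) \<partial>M) = (\<integral>\<^sup>+p. g p \<partial>(distr M S X \<Otimes>\<^sub>M distr M T Y))"
    using g by (simp add: nn_integral_distr)
  also have "\<dots> = (\<integral>\<^sup>+x. \<integral>\<^sup>+y. g (x, y) \<partial>distr M T Y \<partial>distr M S X)"
  proof (rule Y.nn_integral_fst[symmetric])
    show "g \<in> borel_measurable (distr M S X \<Otimes>\<^sub>M distr M T Y)"
      using g by (simp cong: measurable_cong_sets sets_pair_measure_cong)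
  qed
  also have "\<dots> = (\<integral>\<^sup>+\<omega>'. (\<integral>\<^sup>+y. g (X \<omega>', y) \<partial>distr M T Y) \<partial>M)"
  proof (rule nn_integral_distr)
    have [measurable]: "(\<lambda>(x, y). g (x, y)) \<in> borel_measurable (S \<Otimes>\<^sub>M distr M T Y)"
      using g by (simp add: case_prod_beta' cong: measurable_cong_sets sets_pair_measure_cong)
    show "(\<lambda>x. \<integral>\<^sup>+y. g (x, y) \<partial>distr M T Y) \<in> borel_measurable (distr M S X)"
      by measurable
  qed simp
  also have "\<dots> = (\<integral>\<^sup>+\<omega>'. (\<integral>\<^sup>+\<omega>. g (X \<omega>', Y \<omega>) \<partial>M) \<partial>M)"
  proof (rule nn_integral_cong)
    fix \<omega>' assume "\<omega>' \<in> space M"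
    then have "X \<omega>' \<in> space S" by (rule measurable_space[OF \<open>X \<in> measurable M S\<close>])
    then have "(\<lambda>y. g (X \<omega>', y)) \<in> borel_measurable T" using g by measurable
    then show "(\<integral>\<^sup>+y. g (X \<omega>', y) \<partial>distr M T Y) = (\<integral>\<^sup>+\<omega>. g (X \<omega>', Y \<omega>) \<partial>M)"
      by (intro nn_integral_distr) simp_all
  qed
  finally show ?thesis .
qed

lemma (in prob_space) nn_integral_independent_le:
  assumes "independent_rvs M S X T Y" "g \<in> borel_measurable (S \<Otimes>\<^sub>M T)"
    and "\<And>x. x \<in> space S \<Longrightarrow> (\<integral>\<^sup>+\<omega>. g (x, Y \<omega>) \<partial>M) \<le> f x"
  shows "(\<integral>\<^sup>+\<omega>. g (X \<omega>, Y \<omega>) \<partial>M) \<le> (\<integral>\<^sup>+\<omega>. f (X \<omega>) \<partial>M)"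
proof -
  have "X \<in> measurable M S" using assms(1) by (simp add: independent_rvs_def)
  then show ?thesis
    unfolding nn_integral_independent[OF assms(1,2)]
    by (intro nn_integral_mono assms(3)) (rule measurable_space)
qed


text \<open>Values in \<open>ennreal\<close> admit an infinite initial error. The induction rests on
  \<open>a (a^j - 1) / (a - 1) + 1 = (a^(j+1) - 1) / (a - 1)\<close>.\<close>

lemma geometric_recursion_le:
  fixes L :: "nat \<Rightarrow> ennreal"
  assumes step: "\<And>i. L (Suc i) \<le> ennreal a * L i + ennreal c" and "a > 1" "c \<ge> 0"
  shows "L j \<le> ennreal (a ^ j) * L 0 + ennreal (c * ((a ^ j - 1) / (a - 1)))"
proof (induction j)
  case (Suc j)
  have a: "a ^ j \<ge> 1" using \<open>a > 1\<close> by simp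
  have nn: "c * ((a ^ j - 1) / (a - 1)) \<ge> 0" using a \<open>a > 1\<close> \<open>c \<ge> 0\<close> by simp
  have "L (Suc j) \<le> ennreal a * L j + ennreal c" by (rule step)
  also have "\<dots> \<le> ennreal a * (ennreal (a ^ j) * L 0 + ennreal (c * ((a ^ j - 1) / (a - 1)))) + ennreal c"
    by (intro add_right_mono mult_left_mono Suc.IH) simp
  also have "\<dots> = ennreal (a ^ Suc j) * L 0 + ennreal (a * (c * ((a ^ j - 1) / (a - 1))) + c)"
    using \<open>a > 1\<close> \<open>c \<ge> 0\<close> nn a
    by (simp add: distrib_left ennreal_mult mult.assoc[symmetric] add.assoc del: times_divide_eq_right)
  also have "a * (c * ((a ^ j - 1) / (a - 1))) + c = c * ((a ^ Suc j - 1) / (a - 1))"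
    using \<open>a > 1\<close> by (simp add: field_simps)
  finally show ?case .
qed simp


section \<open>The error recursion\<close>

theorem theorem2:
  fixes M :: "'w measure"
    and F :: "'a::{real_inner, banach, second_countable_topology} \<Rightarrow> 'a"
    and \<Psi> :: "real \<Rightarrow> 'a \<Rightarrow> 'a"
    and H \<Gamma> :: "'a \<Rightarrow> 'a"
    and u y \<xi> :: "nat \<Rightarrow> 'w \<Rightarrow> 'a"
    and V :: "nat \<Rightarrow> 'w \<Rightarrow> 'a ^ 'n::finite"
    and \<mu>0 :: "'a measure"
    and h \<rho> \<beta> \<gamma> :: real
    and j :: nat
  assumes "prob_space M"
    and semigroup: "generates_analytic_semigroup F \<Psi>"
    and "h > 0"
    and step_measurable: "\<Psi> h \<in> borel_measurable borel"
    and truth: "\<And>i \<omega>. \<omega> \<in> space M \<Longrightarrow> u (Suc i) \<omega> = \<Psi> h (u i \<omega>)"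
    and operators: "observation_operators H \<Gamma>"
    and observations: "\<And>i \<omega>. i \<ge> 1 \<Longrightarrow> \<omega> \<in> space M \<Longrightarrow> y i \<omega> = H (u i \<omega>) + \<xi> i \<omega>"
    and noise_gaussian: "\<And>i. i \<ge> 1 \<Longrightarrow> centered_gaussian M \<Gamma> (\<xi> i)"
    and noise_indep: "prob_space.indep_vars M (\<lambda>_. borel) \<xi> {1..}"
    and samples_indep:
      "prob_space.indep_vars M (\<lambda>_. borel) (\<lambda>n \<omega>. V 0 \<omega> $ n) UNIV"
    and samples_law: "\<And>n. distr M borel (\<lambda>\<omega>. V 0 \<omega> $ n) = \<mu>0"
    and initial_noise_indep:
      "independent_rvs M
         (borel \<Otimes>\<^sub>M (\<Pi>\<^sub>M n\<in>UNIV. borel)) (\<lambda>\<omega>. (u 0 \<omega>, \<lambda>n. V 0 \<omega> $ n))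
         (\<Pi>\<^sub>M i\<in>{1..}. borel) (\<lambda>\<omega>. \<lambda>i\<in>{1..}. \<xi> i \<omega>)"
    and filter: "\<And>\<omega>. \<omega> \<in> space M \<Longrightarrow> etkf (\<Psi> h) H \<Gamma> (\<lambda>i. y i \<omega>) (\<lambda>i. V i \<omega>)"
    and "\<rho> > 0"
    and absorbing: "\<And>v t. v \<in> cball 0 \<rho> \<Longrightarrow> t \<ge> 0 \<Longrightarrow> \<Psi> t v \<in> cball 0 \<rho>"
    and initial_in_ball: "AE \<omega> in M. u 0 \<omega> \<in> cball 0 \<rho>"
    and "\<beta> > 0"
    and one_sided: "\<And>v w. v \<in> cball 0 \<rho> \<Longrightarrow> (F v - F w) \<bullet> (v - w) \<le> \<beta> * (norm (v - w))\<^sup>2"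
    and "\<gamma> > 0"
    and full_observation: "H = (\<lambda>v. v)" "\<Gamma> = (\<lambda>v. \<gamma>\<^sup>2 *\<^sub>R v)"
    and "j \<ge> 1"
  shows "(\<integral>\<^sup>+\<omega>. ennreal (mean_square_error (V j \<omega>) (u j \<omega>)) \<partial>M)
    \<le> ennreal (exp (2 * \<beta> * h * real j)) *
        (\<integral>\<^sup>+\<omega>. ennreal (mean_square_error (V 0 \<omega>) (u 0 \<omega>)) \<partial>M)
      + ennreal ((real CARD('n) - 1) * \<gamma>\<^sup>2 *
          ((exp (2 * \<beta> * h * real j) - 1) / (exp (2 * \<beta> * h) - 1)))"
proof -
  interpret prob_space M by fact
  let ?mse = "\<lambda>i \<omega>. mean_square_error (V i \<omega>) (u i \<omega>)"
  define c where "c = (real CARD('n) - 1) * \<gamma>\<^sup>2"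
  define L where "L i = (\<integral>\<^sup>+\<omega>. ennreal (?mse i \<omega>) \<partial>M)" for i
  define SA :: "('a \<times> ('n \<Rightarrow> 'a)) measure" where "SA = borel \<Otimes>\<^sub>M (\<Pi>\<^sub>M n\<in>UNIV. borel)"
  define PN :: "nat set \<Rightarrow> (nat \<Rightarrow> 'a) measure" where "PN J = (\<Pi>\<^sub>M i\<in>J. borel)" for J
  define A where "A \<omega> = (u 0 \<omega>, \<lambda>n. V 0 \<omega> $ n)" for \<omega>
  define \<Xi> where "\<Xi> J \<omega> = restrict (\<lambda>i. \<xi> i \<omega>) J" for J \<omega>
  have "c \<ge> 0" by (simp add: c_def)
  note step_measurable[measurable]
  have ind: "independent_rvs M SA A (PN {1..}) (\<Xi> {1..})"
    using initial_noise_indep unfolding SA_def PN_def A_def \<Xi>_def .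
  then have A_meas[measurable]: "A \<in> measurable M SA" by (simp add: independent_rvs_def)
  have \<Xi>_meas[measurable]: "\<Xi> J \<in> measurable M (PN J)" if "J \<subseteq> {1..}" for J
  proof -
    have "\<xi> i \<in> borel_measurable M" if "i \<in> J" for i
      using noise_gaussian[of i] that \<open>J \<subseteq> {1..}\<close> by (auto simp: centered_gaussian_def)
    then show ?thesis unfolding \<Xi>_def PN_def by (rule measurable_restrict)
  qed
  have ind_step: "independent_rvs M (PN {1..i}) (\<Xi> {1..i}) (PN {Suc i}) (\<Xi> {Suc i})" for i
    using indep_var_restrict[OF noise_indep, of "{1..i}" "{Suc i}"]
    unfolding PN_def \<Xi>_def by (intro indep_var_imp_independent_rvs) auto
  have nth_meas: "(\<lambda>b. b k) \<in> borel_measurable (PN J)" if "k \<in> J" for k J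
    unfolding PN_def using that by (rule measurable_component_singleton)
  have restrict_meas: "(\<lambda>b. restrict b J) \<in> measurable (PN K) (PN J)" if "J \<subseteq> K" for J K
    unfolding PN_def using that by (rule measurable_restrict_subset)
  have \<Xi>_restrict: "restrict (\<Xi> K \<omega>) J = \<Xi> J \<omega>" if "J \<subseteq> K" for J K \<omega>
    using that by (auto simp: \<Xi>_def fun_eq_iff)
  have V_step: "V (Suc i) \<omega> = etkf_map \<gamma> (ens_map (\<Psi> h) (V i \<omega>)) (\<Psi> h (u i \<omega>) + \<xi> (Suc i) \<omega>)"
    if "\<omega> \<in> space M" for i \<omega>
  proof -
    have "etkf_analysis (\<lambda>v. v) (\<lambda>v. \<gamma>\<^sup>2 *\<^sub>R v) (ens_map (\<Psi> h) (V i \<omega>)) (y (Suc i) \<omega>) (V (Suc i) \<omega>)"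
      using filter[OF that] unfolding full_observation by (auto simp: etkf_def)
    then have "V (Suc i) \<omega> = etkf_map \<gamma> (ens_map (\<Psi> h) (V i \<omega>)) (y (Suc i) \<omega>)"
      by (rule etkf_analysis_eq_map[OF \<open>\<gamma> > 0\<close>])
    also have "y (Suc i) \<omega> = \<Psi> h (u i \<omega>) + \<xi> (Suc i) \<omega>"
      using observations[of "Suc i" \<omega>] truth[of \<omega> i] that by (simp add: full_observation)
    finally show ?thesis .
  qed
  \<comment> \<open>No noise drives the truth, so the initial data alone determine it.\<close>
  have u_rep: "\<exists>p. p \<in> borel_measurable SA \<and> (\<forall>\<omega>\<in>space M. u i \<omega> = p (A \<omega>))" for i
  proof (induction i)
    case 0
    have "fst \<in> borel_measurable SA" unfolding SA_def by simp
    then show ?case by (intro exI[of _ fst]) (simp add: A_def)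
  next
    case (Suc i)
    then obtain p where [measurable]: "p \<in> borel_measurable SA"
      and p: "\<forall>\<omega>\<in>space M. u i \<omega> = p (A \<omega>)" by blast
    have "(\<lambda>x. \<Psi> h (p x)) \<in> borel_measurable SA" by measurable
    then show ?case using p truth by (intro exI[of _ "\<lambda>x. \<Psi> h (p x)"]) simp
  qed
  \<comment> \<open>Causality of the filter: \<open>\<xi> (Suc i)\<close> does not enter the
    ensemble at time \<open>i\<close>.\<close>
  have V_rep: "\<exists>v. (\<forall>n. v n \<in> borel_measurable (SA \<Otimes>\<^sub>M PN {1..i})) \<and>
      (\<forall>\<omega>\<in>space M. \<forall>n. V i \<omega> $ n = v n (A \<omega>, \<Xi> {1..i} \<omega>))" for i
  proof (induction i)
    case 0
    have "(\<lambda>x. snd (fst x) n) \<in> borel_measurable (SA \<Otimes>\<^sub>M PN {1..0})" for n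
      unfolding SA_def by measurable
    then show ?case by (intro exI[of _ "\<lambda>n x. snd (fst x) n"]) (simp add: A_def)
  next
    case (Suc i)
    then obtain v where [measurable]: "\<And>n. v n \<in> borel_measurable (SA \<Otimes>\<^sub>M PN {1..i})"
      and v: "\<And>\<omega> n. \<omega> \<in> space M \<Longrightarrow> V i \<omega> $ n = v n (A \<omega>, \<Xi> {1..i} \<omega>)" by blast
    obtain p where [measurable]: "p \<in> borel_measurable SA"
      and p: "\<forall>\<omega>\<in>space M. u i \<omega> = p (A \<omega>)" using u_rep by blast
    have [measurable]: "(\<lambda>b. restrict b {1..i}) \<in> measurable (PN {1..Suc i}) (PN {1..i})"
      "(\<lambda>b. b (Suc i)) \<in> borel_measurable (PN {1..Suc i})"
      by (auto intro!: restrict_meas nth_meas)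
    \<comment> \<open>The old ensemble is read through the restriction to the past noise; the
      coordinate \<open>Suc i\<close> enters only through the new observation.\<close>
    define v' where "v' n x = etkf_map \<gamma> (\<chi> k. \<Psi> h (v k (fst x, restrict (snd x) {1..i})))
      (\<Psi> h (p (fst x)) + snd x (Suc i)) $ n" for n x
    have "v' n \<in> borel_measurable (SA \<Otimes>\<^sub>M PN {1..Suc i})" for n
      unfolding v'_def
    proof (rule borel_measurable_etkf_map)
      show "(\<lambda>x. (\<chi> k. \<Psi> h (v k (fst x, restrict (snd x) {1..i}))) $ k)
          \<in> borel_measurable (SA \<Otimes>\<^sub>M PN {1..Suc i})" for k
        unfolding vec_lambda_beta by measurable
      show "(\<lambda>x. \<Psi> h (p (fst x)) + snd x (Suc i)) \<in> borel_measurable (SA \<Otimes>\<^sub>M PN {1..Suc i})"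
        by measurable
    qed
    moreover have "V (Suc i) \<omega> $ n = v' n (A \<omega>, \<Xi> {1..Suc i} \<omega>)" if "\<omega> \<in> space M" for \<omega> n
    proof -
      have "ens_map (\<Psi> h) (V i \<omega>) = (\<chi> k. \<Psi> h (v k (A \<omega>, \<Xi> {1..i} \<omega>)))"
        using v[OF that] by (simp add: ens_map_def)
      moreover have "\<Xi> {1..Suc i} \<omega> (Suc i) = \<xi> (Suc i) \<omega>" by (simp add: \<Xi>_def)
      moreover have "restrict (\<Xi> {1..Suc i} \<omega>) {1..i} = \<Xi> {1..i} \<omega>" by (rule \<Xi>_restrict) auto
      ultimately show ?thesis using p that by (simp add: V_step v'_def)
    qed
    ultimately show ?case by blast
  qed
  have u_meas[measurable]: "u i \<in> borel_measurable M" for i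
  proof -
    obtain p where [measurable]: "p \<in> borel_measurable SA"
      and p: "\<forall>\<omega>\<in>space M. u i \<omega> = p (A \<omega>)" using u_rep by blast
    have "(\<lambda>\<omega>. p (A \<omega>)) \<in> borel_measurable M" by measurable
    then show ?thesis using p by (simp cong: measurable_cong)
  qed
  have V_meas[measurable]: "(\<lambda>\<omega>. V i \<omega> $ n) \<in> borel_measurable M" for i n
  proof -
    obtain v where [measurable]: "\<And>n. v n \<in> borel_measurable (SA \<Otimes>\<^sub>M PN {1..i})"
      and v: "\<And>\<omega> n. \<omega> \<in> space M \<Longrightarrow> V i \<omega> $ n = v n (A \<omega>, \<Xi> {1..i} \<omega>)" using V_rep by blast
    have [measurable]: "\<Xi> {1..i} \<in> measurable M (PN {1..i})" by (rule \<Xi>_meas) auto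
    have "(\<lambda>\<omega>. v n (A \<omega>, \<Xi> {1..i} \<omega>)) \<in> borel_measurable M" by measurable
    then show ?thesis using v by (simp cong: measurable_cong)
  qed
  have analysis: "L (Suc i) \<le>
      (\<integral>\<^sup>+\<omega>. ennreal (mean_square_error (ens_map (\<Psi> h) (V i \<omega>)) (\<Psi> h (u i \<omega>)) + c) \<partial>M)" for i
  proof -
    obtain v where [measurable]: "\<And>n. v n \<in> borel_measurable (SA \<Otimes>\<^sub>M PN {1..i})"
      and v: "\<And>\<omega> n. \<omega> \<in> space M \<Longrightarrow> V i \<omega> $ n = v n (A \<omega>, \<Xi> {1..i} \<omega>)" using V_rep by blast
    obtain p where [measurable]: "p \<in> borel_measurable SA"
      and p: "\<forall>\<omega>\<in>space M. u i \<omega> = p (A \<omega>)" using u_rep by blast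
    define W :: "_ \<Rightarrow> _ \<Rightarrow> 'a ^ 'n" where "W a b = (\<chi> k. \<Psi> h (v k (a, b)))" for a b
    define q where "q a = \<Psi> h (p a)" for a
    have q_meas[measurable]: "q \<in> borel_measurable SA" unfolding q_def by measurable
    have W_meas: "(\<lambda>x. W (fst x) (snd x) $ k) \<in> borel_measurable (SA \<Otimes>\<^sub>M PN {1..i})" for k
      unfolding W_def vec_lambda_beta by measurable
    have W: "ens_map (\<Psi> h) (V i \<omega>) = W (A \<omega>) (\<Xi> {1..i} \<omega>)" if "\<omega> \<in> space M" for \<omega>
      using v[OF that] by (simp add: W_def ens_map_def)
    have q: "\<Psi> h (u i \<omega>) = q (A \<omega>)" if "\<omega> \<in> space M" for \<omega>
      using p that by (simp add: q_def)
    define g where "g a b x = ennreal (mean_square_error (etkf_map \<gamma> (W a b) (q a + x)) (q a))"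
      for a b x
    define f where "f a b = ennreal (mean_square_error (W a b) (q a) + c)" for a b
    have g_meas: "(\<lambda>z. g (a z) (b z) (x z)) \<in> borel_measurable N"
      if [measurable]: "a \<in> measurable N SA" "b \<in> measurable N (PN {1..i})" "x \<in> borel_measurable N"
      for N :: "(('a \<times> ('n \<Rightarrow> 'a)) \<times> (nat \<Rightarrow> 'a)) measure" and a b x
    proof -
      have [measurable]: "(\<lambda>z. W (a z) (b z) $ k) \<in> borel_measurable N" for k
        using measurable_compose[OF measurable_Pair[OF that(1,2)] W_meas] by simp
      show ?thesis
        unfolding g_def
        by (intro measurable_compose[OF _ measurable_ennreal] borel_measurable_mean_square_error
            borel_measurable_etkf_map) measurable
    qed
    have [measurable]: "(\<lambda>b. restrict b {1..i}) \<in> measurable (PN {1..}) (PN {1..i})"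
      "(\<lambda>b. b (Suc i)) \<in> borel_measurable (PN {1..})"
      by (auto intro!: restrict_meas nth_meas)
    have f_meas: "(\<lambda>z. f (fst z) (restrict (snd z) {1..i})) \<in> borel_measurable (SA \<Otimes>\<^sub>M PN {1..})"
    proof -
      have [measurable]: "(\<lambda>z. W (fst z) (restrict (snd z) {1..i}) $ k)
          \<in> borel_measurable (SA \<Otimes>\<^sub>M PN {1..})" for k
        unfolding W_def vec_lambda_beta by measurable
      show ?thesis
        unfolding f_def
        by (intro measurable_compose[OF _ measurable_ennreal] borel_measurable_add
            borel_measurable_mean_square_error) measurable
    qed
    have restr: "restrict (\<Xi> {1..} \<omega>) {1..i} = \<Xi> {1..i} \<omega>" for \<omega>
      by (rule \<Xi>_restrict) auto
    have last: "\<Xi> {1..} \<omega> (Suc i) = \<xi> (Suc i) \<omega>" "\<Xi> {Suc i} \<omega> (Suc i) = \<xi> (Suc i) \<omega>" for \<omega>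
      by (simp_all add: \<Xi>_def)
    have "L (Suc i) = (\<integral>\<^sup>+\<omega>. g (A \<omega>) (\<Xi> {1..i} \<omega>) (\<xi> (Suc i) \<omega>) \<partial>M)"
      unfolding L_def g_def using truth by (intro nn_integral_cong) (simp add: V_step W q)
    \<comment> \<open>Independence of the new noise from initial data and past noise jointly is used
      in two stages. First the initial data are frozen, by their independence of the whole noise
      sequence.\<close>
    also have "\<dots> = (\<integral>\<^sup>+\<omega>'. (\<integral>\<^sup>+\<omega>. g (A \<omega>') (\<Xi> {1..i} \<omega>) (\<xi> (Suc i) \<omega>) \<partial>M) \<partial>M)"
    proof -
      have "(\<lambda>z. g (fst z) (restrict (snd z) {1..i}) (snd z (Suc i))) \<in> borel_measurable (SA \<Otimes>\<^sub>M PN {1..})"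
        by (intro g_meas) measurable
      from nn_integral_independent[OF ind this] show ?thesis
        by (simp only: restr last fst_conv snd_conv)
    qed
    \<comment> \<open>With the initial data frozen, past and new noise are independent, so the
      one-step bound averages out \<open>\<xi> (Suc i)\<close>.\<close>
    also have "\<dots> \<le> (\<integral>\<^sup>+\<omega>'. (\<integral>\<^sup>+\<omega>. f (A \<omega>') (\<Xi> {1..i} \<omega>) \<partial>M) \<partial>M)"
    proof (rule nn_integral_mono)
      fix \<omega>' assume "\<omega>' \<in> space M"
      then have a[measurable]: "A \<omega>' \<in> space SA" by (rule measurable_space[OF A_meas])
      have [measurable]: "(\<lambda>z. W (A \<omega>') (fst z) $ k) \<in> borel_measurable (PN {1..i} \<Otimes>\<^sub>M PN {Suc i})" for k
        unfolding W_def vec_lambda_beta by measurable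
      have [measurable]: "(\<lambda>b. b (Suc i)) \<in> borel_measurable (PN {Suc i})"
        by (auto intro!: nth_meas)
      have "(\<lambda>z. g (A \<omega>') (fst z) (snd z (Suc i))) \<in> borel_measurable (PN {1..i} \<Otimes>\<^sub>M PN {Suc i})"
        unfolding g_def
        by (intro measurable_compose[OF _ measurable_ennreal] borel_measurable_mean_square_error
            borel_measurable_etkf_map) measurable
      moreover have "(\<integral>\<^sup>+\<omega>. g (A \<omega>') b (\<Xi> {Suc i} \<omega> (Suc i)) \<partial>M) \<le> f (A \<omega>') b" for b
        using etkf_map_error[OF noise_gaussian[of "Suc i", unfolded full_observation] \<open>\<gamma> > 0\<close>,
            of "W (A \<omega>') b" "q (A \<omega>')"]
        by (simp add: g_def f_def last c_def)
      ultimately show "(\<integral>\<^sup>+\<omega>. g (A \<omega>') (\<Xi> {1..i} \<omega>) (\<xi> (Suc i) \<omega>) \<partial>M)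
          \<le> (\<integral>\<^sup>+\<omega>. f (A \<omega>') (\<Xi> {1..i} \<omega>) \<partial>M)"
        using nn_integral_independent_le[OF ind_step[of i],
            of "\<lambda>z. g (A \<omega>') (fst z) (snd z (Suc i))" "f (A \<omega>')"]
        by (simp add: last)
    qed
    \<comment> \<open>The initial data are released by the same identity read backwards.\<close>
    also have "\<dots> = (\<integral>\<^sup>+\<omega>. f (A \<omega>) (\<Xi> {1..i} \<omega>) \<partial>M)"
      using nn_integral_independent[OF ind f_meas] by (simp only: restr fst_conv snd_conv)
    also have "\<dots> = (\<integral>\<^sup>+\<omega>. ennreal (mean_square_error (ens_map (\<Psi> h) (V i \<omega>)) (\<Psi> h (u i \<omega>)) + c) \<partial>M)"
      unfolding f_def by (intro nn_integral_cong) (simp add: W q)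
    finally show ?thesis .
  qed

  \<comment> \<open>Error growth in the forecast and conclusion\<close>
  have sol: "is_solution F w (\<lambda>t. \<Psi> t w)" for w
    using semigroup by (auto simp: generates_analytic_semigroup_def)
  have contraction: "(norm (\<Psi> h w - \<Psi> h x))\<^sup>2 \<le> exp (2 * \<beta> * h) * (norm (w - x))\<^sup>2"
    if "x \<in> cball 0 \<rho>" for w x
  proof -
    \<comment> \<open>The one-sided bound wants its first argument in the ball, so the trajectory
      from \<open>x\<close> comes first; \<open>absorbing\<close> keeps it there, while the other
      one may roam.\<close>
    have "(norm (\<Psi> h x - \<Psi> h w))\<^sup>2 \<le> exp (2 * \<beta> * h) * (norm (x - w))\<^sup>2"
      using absorbing[OF that] \<open>h > 0\<close> by (intro solution_contraction[OF sol sol] one_sided) auto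
    then show ?thesis by (simp add: norm_minus_commute)
  qed
  have in_ball: "AE \<omega> in M. u i \<omega> \<in> cball 0 \<rho>" for i
  proof (induction i)
    case (Suc i)
    with AE_space show ?case
      by eventually_elim (use absorbing \<open>h > 0\<close> truth in auto)
  qed (rule initial_in_ball)
  have step: "L (Suc i) \<le> ennreal (exp (2 * \<beta> * h)) * L i + ennreal c" for i
  proof -
    have mse_meas: "?mse i \<in> borel_measurable M"
      by (rule borel_measurable_mean_square_error) measurable
    note analysis[of i]
    also have "(\<integral>\<^sup>+\<omega>. ennreal (mean_square_error (ens_map (\<Psi> h) (V i \<omega>)) (\<Psi> h (u i \<omega>)) + c) \<partial>M)
        \<le> (\<integral>\<^sup>+\<omega>. ennreal (exp (2 * \<beta> * h)) * ennreal (?mse i \<omega>) + ennreal c \<partial>M)"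
    \<comment> \<open>The truth is known to lie in the ball only almost surely.\<close>
    proof (rule nn_integral_mono_AE)
      show "AE \<omega> in M. ennreal (mean_square_error (ens_map (\<Psi> h) (V i \<omega>)) (\<Psi> h (u i \<omega>)) + c)
          \<le> ennreal (exp (2 * \<beta> * h)) * ennreal (?mse i \<omega>) + ennreal c"
        using in_ball[of i]
      proof eventually_elim
        case (elim \<omega>)
        have "mean_square_error (ens_map (\<Psi> h) (V i \<omega>)) (\<Psi> h (u i \<omega>)) \<le> exp (2 * \<beta> * h) * ?mse i \<omega>"
          using contraction[OF elim] by (rule mean_square_error_map_le)
        then have "ennreal (mean_square_error (ens_map (\<Psi> h) (V i \<omega>)) (\<Psi> h (u i \<omega>)) + c)
            \<le> ennreal (exp (2 * \<beta> * h) * ?mse i \<omega> + c)"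
          by (intro ennreal_leI) simp
        then show ?case
          using \<open>c \<ge> 0\<close> by (simp add: ennreal_mult mean_square_error_nonneg)
      qed
    qed
    also have "\<dots> = ennreal (exp (2 * \<beta> * h)) * L i + ennreal c"
      using mse_meas by (simp add: L_def nn_integral_add nn_integral_cmult emeasure_space_1)
    finally show ?thesis .
  qed
  \<comment> \<open>The ratio exceeds 1, so the denominator of the geometric sum is
    positive.\<close>
  have "exp (2 * \<beta> * h) > 1" using \<open>\<beta> > 0\<close> \<open>h > 0\<close> by simp
  from geometric_recursion_le[of L, OF step this \<open>c \<ge> 0\<close>, of j]
  show ?thesis
    by (simp add: L_def c_def exp_of_nat_mult[symmetric] mult_ac)
qed

end
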